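(* Let $(X,d,\mu)$ be a metric measure space, let $\Omega\subset X$ be a bounded open set with $\mu(\Omega)<\infty$, let $\nu$ be a Borel regular outer measure on $X$, and let $1\le q<p<\infty$. For $s>0$ set $$\lambda_p(s)=\inf\{\operatorname{cap}_p(G,\Omega): G\subset\Omega,\ \nu(G)\ge s\}.$$ Then $$\int_0^{\nu(\Omega)}\left(\frac{t^{p/q}}{\lambda_p(t)}\right)^{q/(p-q)}\frac{dt}{t}<\infty$$ if and only if there is a constant $c_S$, independent of $u$, such that $$\left(\int_\Omega|u|^q\,d\nu\right)^{1/q}\le c_S\left(\int_\Omega g_u^p\,d\mu\right)^{1/p}$$ for every $u\in N^{1,p}_0(\Omega)\cap C(\Omega)$ and every $p$-weak upper gradient $g_u$ of $u$.
   Context: $(X,d)$ is a metric space and $\mu$ is a Borel regular outer measure on $X$ with $0<\mu(B)<\infty$ for every ball $B=B(x,r)=\{y\in X: d(x,y)<r\}$. A path is a rectifiable non-constant continuous map from a compact interval to $X$. A family $\Gamma$ of paths has zero $p$-modulus if there is a non-negative Borel function $\rho\in L^p(X)$ with $\int_\gamma\rho\,ds=\infty$ for all $\gamma\in\Gamma$; a property holds for $p$-almost every path if the family of paths for which it fails has zero $p$-modulus. A non-negative measurable function $g$ on $X$ is a $p$-weak upper gradient of an extended real-valued function $u$ on $X$ if for $p$-almost every path $\gamma$, with endpoints $x,y$, one has $|u(x)-u(y)|\le\int_\gamma g\,ds$ whenever $u(x),u(y)$ are both finite, and $\int_\gamma g\,ds=\infty$ otherwise. For $u\in L^p(X)$ put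 $\|u\|_{N^{1,p}(X)}=\left(\int_X|u|^p\,d\mu+\inf_g\int_X g^p\,d\mu\right)^{1/p}$, the infimum over all $p$-weak upper gradients $g$ of $u$; $N^{1,p}(X)$ is the space of $u$ with finite norm, modulo $u\sim v$ iff $\|u-v\|_{N^{1,p}(X)}=0$. A property holds $p$-quasieverywhere ($p$-q.e.) if it fails only on a set of $p$-capacity zero, where the $p$-capacity of $A\subset X$ is $\inf\|u\|^p_{N^{1,p}(X)}$ over $u\in N^{1,p}(X)$ with $u\ge1$ on $A$. Then $N^{1,p}_0(\Omega)=\{u|_\Omega: u\in N^{1,p}(X),\ u=0\ p\text{-q.e. on }X\setminus\Omega\}$; its elements are regarded as functions on $X$ by extending them by $0$ outside $\Omega$, and $p$-weak upper gradients $g_u$ are taken for this extension. $C(\Omega)$ denotes the real-valued continuous functions on $\Omega$. For $E\subset\Omega$, $\operatorname{cap}_p(E,\Omega)=\inf\int_\Omega g_u^p\,d\mu$, where the infimum is over all functions $u:X\to\mathbb R$ that are continuous on $\Omega$ with $u=1$ on $E$ and $u=0$ on $X\setminus\Omega$, and all $p$-weak upper gradients $g_u$ of $u$; $\operatorname{cap}_p(E,\Omega)=\infty$ if there are no such functions. In the integral, the integrand is $0$ where $\lambda_p(t)=\infty$ and $\infty$ where $\lambda_p(t)=0$. *)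

theory Defs
  imports "HOL-Analysis.Analysis"
begin

section \<open>Borel regular outer measures and their measures\<close>

definition borel_regular_outer_measure :: "('a::metric_space set \<Rightarrow> ennreal) \<Rightarrow> bool" where
  "borel_regular_outer_measure \<mu> \<longleftrightarrow>
     outer_measure_space UNIV \<mu> \<and>
     sets borel \<subseteq> lambda_system UNIV UNIV \<mu> \<and>
     (\<forall>A. \<exists>B\<in>sets borel. A \<subseteq> B \<and> \<mu> B = \<mu> A)"

definition caratheodory_measure :: "('a set \<Rightarrow> ennreal) \<Rightarrow> 'a measure" where
  "caratheodory_measure \<mu> = measure_of UNIV (lambda_system UNIV UNIV \<mu>) \<mu>"

lemma measure_space_lambda_system_UNIV:
  assumes "outer_measure_space UNIV \<mu>"
  shows "measure_space UNIV (lambda_system UNIV UNIV \<mu>) \<mu>"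
proof -
  interpret P: sigma_algebra UNIV "UNIV :: 'a set set"
    using sigma_algebra_Pow[of "UNIV :: 'a set"] by simp
  show ?thesis by (rule P.caratheodory_lemma[OF assms])
qed

lemma sets_caratheodory_measure:
  assumes "outer_measure_space UNIV \<mu>"
  shows "sets (caratheodory_measure \<mu>) = lambda_system UNIV UNIV \<mu>"
  using measure_space_lambda_system_UNIV[OF assms] unfolding caratheodory_measure_def
  by (intro sigma_algebra.sets_measure_of_eq) (auto simp: measure_space_def)

lemma emeasure_caratheodory_measure:
  assumes "outer_measure_space UNIV \<mu>" "A \<in> lambda_system UNIV UNIV \<mu>"
  shows "emeasure (caratheodory_measure \<mu>) A = \<mu> A"
  using measure_space_lambda_system_UNIV[OF assms(1)] assms(2) unfolding caratheodory_measure_def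
  by (intro emeasure_measure_of_sigma) (auto simp: measure_space_def)


section \<open>Powers of extended non-negative reals\<close>

text \<open>Only used with exponents \<open>a > 0\<close>, so that \<open>0\<close> is sent to \<open>0\<close> and \<open>\<infinity>\<close> to \<open>\<infinity>\<close>.\<close>

definition enn_powr :: "ennreal \<Rightarrow> real \<Rightarrow> ennreal" where
  "enn_powr x a = (if x = \<infinity> then \<infinity> else ennreal (enn2real x powr a))"


section \<open>Paths and path integrals\<close>

text \<open>
  A path is given by a triple \<open>(a, b, \<gamma>)\<close>; only the values of \<open>\<gamma>\<close> on \<open>{a..b}\<close> matter.
\<close>

definition curve_length :: "real \<Rightarrow> real \<Rightarrow> (real \<Rightarrow> 'a::metric_space) \<Rightarrow> ennreal" where
  "curve_length a b \<gamma> =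
     (SUP (n, t) \<in> {(n :: nat, t :: nat \<Rightarrow> real). mono_on {..n} t \<and> t ` {..n} \<subseteq> {a..b}}.
        \<Sum>i<n. ennreal (dist (\<gamma> (t i)) (\<gamma> (t (Suc i)))))"

definition is_path :: "real \<times> real \<times> (real \<Rightarrow> 'a::metric_space) \<Rightarrow> bool" where
  "is_path = (\<lambda>(a, b, \<gamma>).
     a \<le> b \<and> continuous_on {a..b} \<gamma> \<and> curve_length a b \<gamma> < \<infinity> \<and>
     (\<exists>s\<in>{a..b}. \<exists>t\<in>{a..b}. \<gamma> s \<noteq> \<gamma> t))"

text \<open>
  For a path, \<open>t \<mapsto> curve_length a t \<gamma>\<close> is continuous and non-decreasing from \<open>{a..b}\<close> onto
  \<open>[0, curve_length a b \<gamma>]\<close>, and \<open>\<gamma>\<close> is constant on its level sets, so the choice of \<open>t\<close> below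
  exists and does not influence the value.
\<close>

definition arc_length_param :: "real \<Rightarrow> real \<Rightarrow> (real \<Rightarrow> 'a::metric_space) \<Rightarrow> real \<Rightarrow> 'a" where
  "arc_length_param a b \<gamma> s = \<gamma> (SOME t. t \<in> {a..b} \<and> curve_length a t \<gamma> = ennreal s)"

text \<open>
  The Lebesgue integral over the arc-length parametrisation. For a measurable function \<open>\<rho>\<close> on the
  space the composed integrand is Lebesgue measurable for almost every path; on
  other paths the library integral is a lower integral, which no definition below depends on.
\<close>

definition path_integral ::
    "real \<times> real \<times> (real \<Rightarrow> 'a::metric_space) \<Rightarrow> ('a \<Rightarrow> ennreal) \<Rightarrow> ennreal" where
  "path_integral = (\<lambda>(a, b, \<gamma>) \<rho>.
     \<integral>\<^sup>+ s \<in> {0..enn2real (curve_length a b \<gamma>)}. \<rho> (arc_length_param a b \<gamma> s) \<partial>lebesgue)"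


section \<open>Modulus and weak upper gradients\<close>

definition zero_modulus ::
    "('a::metric_space set \<Rightarrow> ennreal) \<Rightarrow> real \<Rightarrow> (real \<times> real \<times> (real \<Rightarrow> 'a)) set \<Rightarrow> bool" where
  "zero_modulus \<mu> p \<Gamma> \<longleftrightarrow>
     (\<exists>\<rho> \<in> borel_measurable borel.
        (\<integral>\<^sup>+ x. enn_powr (\<rho> x) p \<partial>caratheodory_measure \<mu>) < \<infinity> \<and>
        (\<forall>c\<in>\<Gamma>. path_integral c \<rho> = \<infinity>))"

definition almost_every_path ::
    "('a::metric_space set \<Rightarrow> ennreal) \<Rightarrow> real \<Rightarrow> (real \<times> real \<times> (real \<Rightarrow> 'a) \<Rightarrow> bool) \<Rightarrow> bool" where
  "almost_every_path \<mu> p P \<longleftrightarrow> zero_modulus \<mu> p {c. is_path c \<and> \<not> P c}"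

definition weak_upper_gradient ::
    "('a::metric_space set \<Rightarrow> ennreal) \<Rightarrow> real \<Rightarrow> ('a \<Rightarrow> ereal) \<Rightarrow> ('a \<Rightarrow> ennreal) \<Rightarrow> bool" where
  "weak_upper_gradient \<mu> p u g \<longleftrightarrow>
     g \<in> borel_measurable (caratheodory_measure \<mu>) \<and>
     almost_every_path \<mu> p (\<lambda>(a, b, \<gamma>).
       if \<bar>u (\<gamma> a)\<bar> \<noteq> \<infinity> \<and> \<bar>u (\<gamma> b)\<bar> \<noteq> \<infinity>
       then e2ennreal \<bar>u (\<gamma> a) - u (\<gamma> b)\<bar> \<le> path_integral (a, b, \<gamma>) g
       else path_integral (a, b, \<gamma>) g = \<infinity>)"


section \<open>Newtonian spaces and capacities\<close>

definition newtonian_norm ::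
    "('a::metric_space set \<Rightarrow> ennreal) \<Rightarrow> real \<Rightarrow> ('a \<Rightarrow> ereal) \<Rightarrow> ennreal" where
  "newtonian_norm \<mu> p u =
     enn_powr
       ((\<integral>\<^sup>+ x. enn_powr (e2ennreal \<bar>u x\<bar>) p \<partial>caratheodory_measure \<mu>)
        + (INF g \<in> {g. weak_upper_gradient \<mu> p u g}.
             \<integral>\<^sup>+ x. enn_powr (g x) p \<partial>caratheodory_measure \<mu>))
       (1 / p)"

text \<open>
  Elements of Newtonian spaces are treated as everywhere defined functions, not as classes modulo
  functions of norm zero. Membership in \<open>L\<^sup>p\<close> is implied by measurability and finiteness of the norm.
\<close>

definition newtonian :: "('a::metric_space set \<Rightarrow> ennreal) \<Rightarrow> real \<Rightarrow> ('a \<Rightarrow> ereal) set" where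
  "newtonian \<mu> p =
     {u \<in> borel_measurable (caratheodory_measure \<mu>). newtonian_norm \<mu> p u < \<infinity>}"

definition sobolev_capacity ::
    "('a::metric_space set \<Rightarrow> ennreal) \<Rightarrow> real \<Rightarrow> 'a set \<Rightarrow> ennreal" where
  "sobolev_capacity \<mu> p A =
     (INF u \<in> {u \<in> newtonian \<mu> p. \<forall>x\<in>A. u x \<ge> 1}. enn_powr (newtonian_norm \<mu> p u) p)"

definition quasieverywhere ::
    "('a::metric_space set \<Rightarrow> ennreal) \<Rightarrow> real \<Rightarrow> ('a \<Rightarrow> bool) \<Rightarrow> bool" where
  "quasieverywhere \<mu> p P \<longleftrightarrow> sobolev_capacity \<mu> p {x. \<not> P x} = 0"

text \<open>The elements are already extended by zero outside \<open>\<Omega>\<close>.\<close>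

definition newtonian_zero ::
    "('a::metric_space set \<Rightarrow> ennreal) \<Rightarrow> real \<Rightarrow> 'a set \<Rightarrow> ('a \<Rightarrow> ereal) set" where
  "newtonian_zero \<mu> p \<Omega> =
     {(\<lambda>x. if x \<in> \<Omega> then u x else 0) | u.
        u \<in> newtonian \<mu> p \<and> quasieverywhere \<mu> p (\<lambda>x. x \<notin> \<Omega> \<longrightarrow> u x = 0)}"

text \<open>The infimum of the empty set is \<open>\<infinity>\<close> in \<^typ>\<open>ennreal\<close>.\<close>

definition variational_capacity ::
    "('a::metric_space set \<Rightarrow> ennreal) \<Rightarrow> real \<Rightarrow> 'a set \<Rightarrow> 'a set \<Rightarrow> ennreal" where
  "variational_capacity \<mu> p E \<Omega> =
     (INF (u, g) \<in> {(u :: 'a \<Rightarrow> real, g).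
          continuous_on \<Omega> u \<and> (\<forall>x\<in>E. u x = 1) \<and> (\<forall>x\<in>-\<Omega>. u x = 0) \<and>
          weak_upper_gradient \<mu> p (\<lambda>x. ereal (u x)) g}.
        \<integral>\<^sup>+ x \<in> \<Omega>. enn_powr (g x) p \<partial>caratheodory_measure \<mu>)"

definition capacity_profile ::
    "('a::metric_space set \<Rightarrow> ennreal) \<Rightarrow> ('a set \<Rightarrow> ennreal) \<Rightarrow> real \<Rightarrow> 'a set \<Rightarrow> real \<Rightarrow> ennreal" where
  "capacity_profile \<mu> \<nu> p \<Omega> s =
     (INF G \<in> {G. G \<subseteq> \<Omega> \<and> \<nu> G \<ge> ennreal s}. variational_capacity \<mu> p G \<Omega>)"

end

theory Submission
  imports Defs "HOL-Probability.Distribution_Functions"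
begin

text \<open>
  Write \<open>\<beta> = q / (p - q)\<close>. Since \<open>(t\<^sup>p\<^sup>/\<^sup>q)\<^sup>\<beta> / t = t\<^sup>\<beta>\<close>, the integral in the theorem is that of
  \<open>(t / \<lambda>\<^sub>p(t))\<^sup>\<beta>\<close>, and \<open>\<lambda>\<^sub>p\<close> is non-decreasing. The theorem is proved by cutting into dyadic levels:
  of \<open>u\<close> in one direction, of \<open>t\<close> in the other.

  From the integral to the inequality (Maz'ya's truncation). Let \<open>E\<^sub>k = {|u| \<ge> 2\<^sup>k}\<close>. Truncating \<open>|u|\<close>
  between the levels \<open>2\<^sup>k\<^sup>-\<^sup>1\<close> and \<open>2\<^sup>k\<close> gives a test function for the capacity of \<open>E\<^sub>k\<close> whose gradient
  lives between these levels. This bounds the capacity of \<open>E\<^sub>k\<close> by numbers \<open>c\<^sub>k\<close> such that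
  \<open>\<Sum>\<^sub>k 2\<^sup>k\<^sup>p c\<^sub>k\<close> is at most a multiple of the energy \<open>\<integral> g\<^sup>p d\<mu>\<close>. The \<open>\<nu>\<close>-measure \<open>d\<close> of
  \<open>E\<^sub>k - E\<^sub>k\<^sub>+\<^sub>1\<close> is the length of the interval from \<open>\<nu>(E\<^sub>k\<^sub>+\<^sub>1)\<close> to \<open>\<nu>(E\<^sub>k)\<close>, on which \<open>\<lambda>\<^sub>p \<le> c\<^sub>k\<close>. Either \<open>2\<^sup>k\<^sup>q d \<le> 2\<^sup>k\<^sup>p c\<^sub>k\<close>, or
  \<open>c\<^sub>k\<close> is so small that the integrand is at least a multiple of \<open>2\<^sup>k\<^sup>q\<close> on half of this interval
  (lemma \<open>level_dichotomy\<close>). If the levels are taken proportional to the \<open>p\<close>-th root of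
  the energy, summing over \<open>k\<close> gives the inequality (lemma \<open>dyadic_level_estimate\<close>).

  From the inequality to the integral. For finitely many \<open>j\<close> pick nearly optimal sets \<open>G\<^sub>j\<close> with
  \<open>\<nu>(G\<^sub>j) \<ge> 2\<^sup>j\<close> and test functions for them, and insert the maximum of suitable multiples of these
  into the inequality. Both sides are comparable with powers of the dyadic sum \<open>T\<close> for the integral, and
  \<open>T \<le> C T\<^sup>q\<^sup>/\<^sup>p\<close> with \<open>q < p\<close> bounds \<open>T\<close> independently of the set of \<open>j\<close>
  (lemmas \<open>sum_level_sets_le_nn_integral\<close> and \<open>dyadic_sum_bound\<close>).

  The analytic input is that weak upper gradients may be localised: to \<open>\<Omega>\<close> for a non-negative function vanishing
  outside it (lemma \<open>weak_upper_gradient_restrict\<close>), and to the slice between two levels for a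
  truncation (lemma \<open>weak_upper_gradient_truncate\<close>). Both follow by choosing one subpath that
  accounts for the whole increment and whose interior lies in the region in question. This needs
  integrals over subpaths to be integrals over subintervals of a single arc-length parametrisation,
  hence additivity and continuity of the length; it also needs measurable integrands, which is why
  every weak upper gradient is first replaced by a Borel majorant.
\<close>


section \<open>Length and arc-length parametrisation of curves\<close>

definition subdivision_of :: "real \<Rightarrow> real \<Rightarrow> nat \<Rightarrow> (nat \<Rightarrow> real) \<Rightarrow> bool" where
  "subdivision_of a b n t \<longleftrightarrow> mono_on {..n} t \<and> t ` {..n} \<subseteq> {a..b}"

definition polygon_length :: "(real \<Rightarrow> 'a::metric_space) \<Rightarrow> nat \<Rightarrow> (nat \<Rightarrow> real) \<Rightarrow> ennreal" where
  "polygon_length \<gamma> n t = (\<Sum>i<n. ennreal (dist (\<gamma> (t i)) (\<gamma> (t (Suc i)))))"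

lemma curve_length_SUP:
  "curve_length a b \<gamma> = (SUP (n, t) \<in> {(n, t). subdivision_of a b n t}. polygon_length \<gamma> n t)"
  by (simp add: curve_length_def subdivision_of_def polygon_length_def)

lemma polygon_length_le_curve_length:
  "subdivision_of a b n t \<Longrightarrow> polygon_length \<gamma> n t \<le> curve_length a b \<gamma>"
  unfolding curve_length_SUP by (rule SUP_upper2[of "(n, t)"]) auto

lemma curve_length_leI:
  "(\<And>n t. subdivision_of a b n t \<Longrightarrow> polygon_length \<gamma> n t \<le> C) \<Longrightarrow> curve_length a b \<gamma> \<le> C"
  unfolding curve_length_SUP by (rule SUP_least) auto

lemma dist_le_curve_length:
  assumes "a \<le> s" "s \<le> t" "t \<le> b"
  shows "ennreal (dist (\<gamma> s) (\<gamma> t)) \<le> curve_length a b \<gamma>"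
proof -
  have "subdivision_of a b 1 (\<lambda>i. if i = 0 then s else t)"
    using assms by (auto simp: subdivision_of_def mono_on_def)
  from polygon_length_le_curve_length[OF this, of \<gamma>] show ?thesis
    by (simp add: polygon_length_def)
qed

lemma subdivision_of_min:
  "subdivision_of a b n t \<Longrightarrow> a \<le> c \<Longrightarrow> subdivision_of a c n (\<lambda>i. min (t i) c)"
  unfolding subdivision_of_def mono_on_def image_subset_iff atLeastAtMost_iff
  by (meson min.mono min.cobounded2 min.boundedI order_refl)

lemma subdivision_of_max:
  "subdivision_of a b n t \<Longrightarrow> c \<le> b \<Longrightarrow> subdivision_of c b n (\<lambda>i. max (t i) c)"
  unfolding subdivision_of_def mono_on_def image_subset_iff atLeastAtMost_iff
  by (meson max.mono max.cobounded2 max.boundedI order_refl)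

text \<open>
  Additivity: cutting a polygon at \<open>c\<close> (by clamping its nodes to either side) does not decrease
  its length, and inscribed polygons of the two halves can be concatenated.
\<close>

lemma curve_length_add:
  assumes "a \<le> c" "c \<le> b"
  shows "curve_length a b \<gamma> = curve_length a c \<gamma> + curve_length c b \<gamma>"
proof (rule antisym)
  show "curve_length a b \<gamma> \<le> curve_length a c \<gamma> + curve_length c b \<gamma>"
  proof (rule curve_length_leI)
    fix n t assume sub: "subdivision_of a b n t"
    have "polygon_length \<gamma> n t
        \<le> polygon_length \<gamma> n (\<lambda>i. min (t i) c) + polygon_length \<gamma> n (\<lambda>i. max (t i) c)"
      unfolding polygon_length_def sum.distrib[symmetric]
    proof (rule sum_mono)
      fix i assume "i \<in> {..<n}"
      then have "t i \<le> t (Suc i)"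
        using sub by (auto simp: subdivision_of_def mono_on_def)
      then have "dist (\<gamma> (t i)) (\<gamma> (t (Suc i)))
          \<le> dist (\<gamma> (min (t i) c)) (\<gamma> (min (t (Suc i)) c))
            + dist (\<gamma> (max (t i) c)) (\<gamma> (max (t (Suc i)) c))"
        using dist_triangle[of "\<gamma> (t i)" "\<gamma> (t (Suc i))" "\<gamma> c"] by (auto simp: min_def max_def)
      then show "ennreal (dist (\<gamma> (t i)) (\<gamma> (t (Suc i))))
          \<le> ennreal (dist (\<gamma> (min (t i) c)) (\<gamma> (min (t (Suc i)) c)))
            + ennreal (dist (\<gamma> (max (t i) c)) (\<gamma> (max (t (Suc i)) c)))"
        by (simp flip: ennreal_plus add: ennreal_leI)
    qed
    also have "\<dots> \<le> curve_length a c \<gamma> + curve_length c b \<gamma>"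
      using sub assms
      by (intro add_mono polygon_length_le_curve_length subdivision_of_min subdivision_of_max)
    finally show "polygon_length \<gamma> n t \<le> curve_length a c \<gamma> + curve_length c b \<gamma>" .
  qed
next
  have concat: "polygon_length \<gamma> n t + polygon_length \<gamma> m s \<le> curve_length a b \<gamma>"
    if t: "subdivision_of a c n t" and s: "subdivision_of c b m s" for n t m s
  proof -
    define r where "r i = (if i \<le> n then t i else s (i - Suc n))" for i
    have tc: "t i \<in> {a..c}" if "i \<le> n" for i
      using t that by (auto simp: subdivision_of_def image_subset_iff)
    have sc: "s i \<in> {c..b}" if "i \<le> m" for i
      using s that by (auto simp: subdivision_of_def image_subset_iff)
    have "subdivision_of a b (Suc n + m) r"
      unfolding subdivision_of_def
    proof (intro conjI mono_onI image_subsetI)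
      fix i j assume ij: "i \<in> {..Suc n + m}" "j \<in> {..Suc n + m}" "i \<le> j"
      consider "j \<le> n" | "i \<le> n" "n < j" | "n < i" using ij(3) by linarith
      then show "r i \<le> r j"
      proof cases
        case 1 then show ?thesis
          using t ij by (auto simp: r_def subdivision_of_def mono_on_def)
      next
        case 2
        then have "t i \<le> c" "c \<le> s (j - Suc n)" using tc[of i] sc[of "j - Suc n"] ij by auto
        then show ?thesis using 2 by (simp add: r_def)
      next
        case 3
        then have "i - Suc n \<le> m" "j - Suc n \<le> m" "i - Suc n \<le> j - Suc n" using ij by auto
        then show ?thesis
          using s ij 3 by (simp add: r_def subdivision_of_def mono_on_def)
      qed
    next
      fix i assume "i \<in> {..Suc n + m}"
      then have "i - Suc n \<le> m" by auto
      then show "r i \<in> {a..b}"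
        using tc[of i] sc[of "i - Suc n"] assms by (cases "i \<le> n") (auto simp: r_def)
    qed
    from polygon_length_le_curve_length[OF this, of \<gamma>]
    have "polygon_length \<gamma> (Suc n + m) r \<le> curve_length a b \<gamma>" .
    moreover have "polygon_length \<gamma> n t + polygon_length \<gamma> m s \<le> polygon_length \<gamma> (Suc n + m) r"
    proof -
      have "polygon_length \<gamma> (Suc n + m) r
          = (\<Sum>i<Suc n. ennreal (dist (\<gamma> (r i)) (\<gamma> (r (Suc i)))))
            + (\<Sum>i<m. ennreal (dist (\<gamma> (r (Suc n + i))) (\<gamma> (r (Suc (Suc n + i))))))"
        unfolding polygon_length_def by (induction m) (auto simp: add.assoc)
      also have "(\<Sum>i<m. ennreal (dist (\<gamma> (r (Suc n + i))) (\<gamma> (r (Suc (Suc n + i))))))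
          = polygon_length \<gamma> m s"
        by (simp add: polygon_length_def r_def)
      finally have split: "polygon_length \<gamma> (Suc n + m) r
          = (\<Sum>i<Suc n. ennreal (dist (\<gamma> (r i)) (\<gamma> (r (Suc i))))) + polygon_length \<gamma> m s" .
      have "polygon_length \<gamma> n t \<le> (\<Sum>i<Suc n. ennreal (dist (\<gamma> (r i)) (\<gamma> (r (Suc i)))))"
        by (simp add: polygon_length_def r_def)
      then show ?thesis unfolding split by (rule add_right_mono)
    qed
    ultimately show ?thesis by simp
  qed
  have ne: "{(n, t). subdivision_of u v n t} \<noteq> {}" if "u \<le> v" for u v
  proof -
    have "subdivision_of u v 0 (\<lambda>_. u)" using that by (auto simp: subdivision_of_def mono_on_def)
    then show ?thesis by blast
  qed
  have "polygon_length \<gamma> n t + curve_length c b \<gamma> \<le> curve_length a b \<gamma>"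
    if t: "subdivision_of a c n t" for n t
    unfolding curve_length_SUP[of c b]
    using concat[OF t] by (subst ennreal_SUP_add_right[OF ne[OF assms(2)]]) (auto intro!: SUP_least)
  then show "curve_length a c \<gamma> + curve_length c b \<gamma> \<le> curve_length a b \<gamma>"
    unfolding curve_length_SUP[of a c]
    by (subst ennreal_SUP_add_left[OF ne[OF assms(1)], symmetric]) (auto intro!: SUP_least)
qed

lemma curve_length_point [simp]: "curve_length a a \<gamma> = 0"
proof -
  have "curve_length a a \<gamma> \<le> 0"
  proof (rule curve_length_leI)
    fix n t assume "subdivision_of a a n t"
    then have "t i = a" if "i \<le> n" for i using that by (auto simp: subdivision_of_def)
    then show "polygon_length \<gamma> n t \<le> 0" by (simp add: polygon_length_def)
  qed
  then show ?thesis by simp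
qed

lemma curve_length_mono:
  assumes "a \<le> c" "c \<le> d" "d \<le> b"
  shows "curve_length c d \<gamma> \<le> curve_length a b \<gamma>"
  using curve_length_add[of a c b \<gamma>] curve_length_add[of c d b \<gamma>] assms by (simp add: add_increasing add_increasing2)

locale rectifiable_curve =
  fixes a b :: real and \<gamma> :: "real \<Rightarrow> 'a::metric_space"
  assumes ab: "a \<le> b" and cont: "continuous_on {a..b} \<gamma>" and finite_length: "curve_length a b \<gamma> < \<infinity>"
begin

definition len :: "real \<Rightarrow> real" where "len t = enn2real (curve_length a t \<gamma>)"

lemma curve_length_eq_len:
  assumes "a \<le> s" "s \<le> t" "t \<le> b"
  shows "curve_length s t \<gamma> = ennreal (len t - len s)" "len s \<le> len t"
proof -
  have fin: "curve_length a t \<gamma> < \<infinity>" "curve_length a s \<gamma> < \<infinity>" "curve_length s t \<gamma> < \<infinity>"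
    using curve_length_mono[of a a t b \<gamma>] curve_length_mono[of a a s b \<gamma>]
      curve_length_mono[of a s t b \<gamma>] assms finite_length by (auto simp: less_top[symmetric] top_unique)
  have add: "curve_length a t \<gamma> = curve_length a s \<gamma> + curve_length s t \<gamma>"
    using assms by (intro curve_length_add) auto
  show "curve_length s t \<gamma> = ennreal (len t - len s)" "len s \<le> len t"
    using fin by (auto simp: add len_def enn2real_plus)
qed

lemma len_start [simp]: "len a = 0"
  by (simp add: len_def)

lemma len_nonneg: "0 \<le> len t"
  by (simp add: len_def)

lemma curve_length_start: "t \<in> {a..b} \<Longrightarrow> curve_length a t \<gamma> = ennreal (len t)"
  using curve_length_eq_len(1)[of a t] by simp

lemma len_mono: "a \<le> s \<Longrightarrow> s \<le> t \<Longrightarrow> t \<le> b \<Longrightarrow> len s \<le> len t"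
  by (rule curve_length_eq_len)

lemma dist_le_len:
  assumes "s \<in> {a..b}" "t \<in> {a..b}"
  shows "dist (\<gamma> s) (\<gamma> t) \<le> \<bar>len t - len s\<bar>"
proof -
  have *: "dist (\<gamma> s) (\<gamma> t) \<le> \<bar>len t - len s\<bar>" if "s \<le> t" "a \<le> s" "t \<le> b" for s t
    using dist_le_curve_length[of s s t t \<gamma>] curve_length_eq_len[of s t] that by simp
  show ?thesis
    using *[of s t] *[of t s] assms by (cases "s \<le> t") (auto simp: dist_commute abs_minus_commute)
qed

text \<open>
  The length of an initial piece is a supremum of functions that are continuous in the right end
  point, hence lower semicontinuous; so is the length of the final piece. As the two add up to a
  constant, both are continuous.
\<close>


lemma continuous_on_len: "continuous_on {a..b} len"
proof -
  have lower: "\<forall>\<^sub>F s in at t within {a..b}. len t - e < len s"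
    if t: "t \<in> {a..b}" and e: "e > 0" for t e
  proof (cases "len t < e")
    case True then show ?thesis using len_nonneg by (auto intro!: always_eventually) (smt (verit) len_nonneg)
  next
    case False
    then have "ennreal (len t - e) < curve_length a t \<gamma>"
      unfolding curve_length_start[OF t] using e by (intro ennreal_lessI) auto
    then obtain n r where r: "subdivision_of a t n r" "ennreal (len t - e) < polygon_length \<gamma> n r"
      unfolding curve_length_SUP less_SUP_iff by auto
    \<comment> \<open>Cutting the nodes off at \<open>s\<close> makes this polygon a continuous lower bound for the length up to \<open>s\<close>.\<close>
    define P where "P s = (\<Sum>i<n. dist (\<gamma> (min (r i) s)) (\<gamma> (min (r (Suc i)) s)))" for s
    have rt: "r i \<in> {a..t}" if "i \<le> n" for i
      using r that by (auto simp: subdivision_of_def image_subset_iff)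
    have "continuous_on {a..b} P" unfolding P_def
      by (intro continuous_intros continuous_on_compose2[OF cont]) (use rt t in \<open>fastforce simp: min_def\<close>)+
    then have "(P \<longlongrightarrow> P t) (at t within {a..b})" using t by (simp add: continuous_on_def)
    moreover have "len t - e < P t"
    proof -
      have "polygon_length \<gamma> n r = ennreal (P t)"
        unfolding polygon_length_def P_def using rt
        by (subst sum_ennreal) (auto intro!: sum.cong simp: min_absorb1)
      then show ?thesis using r(2) False by (simp add: ennreal_less_iff)
    qed
    ultimately have "\<forall>\<^sub>F s in at t within {a..b}. len t - e < P s"
      by (rule order_tendstoD)
    moreover have "\<forall>\<^sub>F s in at t within {a..b}. s \<in> {a..b}"
      by (simp add: eventually_at_filter)
    ultimately show ?thesis
    proof eventually_elim
      case (elim s)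
      have "ennreal (P s) = polygon_length \<gamma> n (\<lambda>i. min (r i) s)"
        unfolding polygon_length_def P_def by (rule sum_ennreal[symmetric]) simp
      also have "\<dots> \<le> curve_length a s \<gamma>"
        using r(1) elim by (intro polygon_length_le_curve_length subdivision_of_min) auto
      finally have "P s \<le> len s" using elim curve_length_start[of s] len_nonneg[of s] by simp
      then show ?case using elim by simp
    qed
  qed
  have upper: "\<forall>\<^sub>F s in at t within {a..b}. len s < len t + e"
    if t: "t \<in> {a..b}" and e: "e > 0" for t e
  proof (cases "len b - len t < e")
    case True 
    have "\<forall>\<^sub>F s in at t within {a..b}. s \<in> {a..b}"
      by (simp add: eventually_at_filter)
    then show ?thesis 
    proof eventually_elim
      case (elim s) then show ?case using len_mono[of s b] True by auto
    qed
  next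
    case False
    then have "ennreal (len b - len t - e) < curve_length t b \<gamma>"
      using e t by (subst curve_length_eq_len) (auto intro!: ennreal_lessI)
    then obtain n r where r: "subdivision_of t b n r" "ennreal (len b - len t - e) < polygon_length \<gamma> n r"
      unfolding curve_length_SUP less_SUP_iff by auto
    define P where "P s = (\<Sum>i<n. dist (\<gamma> (max (r i) s)) (\<gamma> (max (r (Suc i)) s)))" for s
    have rt: "r i \<in> {t..b}" if "i \<le> n" for i
      using r that by (auto simp: subdivision_of_def image_subset_iff)
    have "continuous_on {a..b} P" unfolding P_def
      by (intro continuous_intros continuous_on_compose2[OF cont]) (use rt t in \<open>fastforce simp: max_def\<close>)+
    then have "(P \<longlongrightarrow> P t) (at t within {a..b})" using t by (simp add: continuous_on_def)
    moreover have "len b - len t - e < P t"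
    proof -
      have "polygon_length \<gamma> n r = ennreal (P t)"
        unfolding polygon_length_def P_def using rt
        by (subst sum_ennreal) (auto intro!: sum.cong simp: max_absorb1)
      then show ?thesis using r(2) False by (simp add: ennreal_less_iff)
    qed
    ultimately have "\<forall>\<^sub>F s in at t within {a..b}. len b - len t - e < P s"
      by (rule order_tendstoD)
    moreover have "\<forall>\<^sub>F s in at t within {a..b}. s \<in> {a..b}"
      by (simp add: eventually_at_filter)
    ultimately show ?thesis
    proof eventually_elim
      case (elim s)
      have "ennreal (P s) = polygon_length \<gamma> n (\<lambda>i. max (r i) s)"
        unfolding polygon_length_def P_def by (rule sum_ennreal[symmetric]) simp
      also have "\<dots> \<le> curve_length s b \<gamma>"
        using r(1) elim by (intro polygon_length_le_curve_length subdivision_of_max) auto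
      also have "\<dots> = ennreal (len b - len s)"
        using elim by (intro curve_length_eq_len) auto
      finally have "P s \<le> len b - len s" using elim len_mono[of s b] by simp
      then show ?case using elim by simp
    qed
  qed
  show ?thesis
    unfolding continuous_on_def
  proof (intro ballI order_tendstoI)
    fix t y assume "t \<in> {a..b}" "y < len t"
    then show "\<forall>\<^sub>F s in at t within {a..b}. y < len s" using lower[of t "len t - y"] by simp
  next
    fix t y assume "t \<in> {a..b}" "len t < y"
    then show "\<forall>\<^sub>F s in at t within {a..b}. len s < y" using upper[of t "y - len t"] by simp
  qed
qed

lemma len_surj:
  assumes "s \<in> {0..len b}"
  obtains t where "t \<in> {a..b}" "len t = s"
  using IVT'[of len a s b] ab assms continuous_on_len by auto

lemma sub: "a \<le> c \<Longrightarrow> c \<le> d \<Longrightarrow> d \<le> b \<Longrightarrow> rectifiable_curve c d \<gamma>"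
  using curve_length_mono[of a c d b \<gamma>] finite_length
  by unfold_locales (auto intro: continuous_on_subset[OF cont] simp: less_top[symmetric] top_unique)

text \<open>
  The arbitrary choice of a parameter of given arc length does not matter: two such parameters
  bound a piece of length zero, on which the curve is constant.
\<close>

lemma sub_arc_length_param:
  assumes cd: "a \<le> c" "c \<le> d" "d \<le> b" and t: "t \<in> {c..d}"
  shows "arc_length_param c d \<gamma> (len t - len c) = \<gamma> t"
proof -
  define t' where "t' = (SOME r. r \<in> {c..d} \<and> curve_length c r \<gamma> = ennreal (len t - len c))"
  have "t \<in> {c..d} \<and> curve_length c t \<gamma> = ennreal (len t - len c)"
    using curve_length_eq_len(1)[of c t] cd t by auto
  then have "t' \<in> {c..d} \<and> curve_length c t' \<gamma> = ennreal (len t - len c)"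
    unfolding t'_def by (rule someI)
  moreover from this have "ennreal (len t' - len c) = ennreal (len t - len c)"
    using cd curve_length_eq_len(1)[of c t'] by auto
  ultimately have "t' \<in> {c..d}" "len t' = len t"
    using len_mono[of c t] len_mono[of c t'] cd t by auto
  then have "dist (\<gamma> t') (\<gamma> t) \<le> 0"
    using dist_le_len[of t' t] cd t by auto
  then show ?thesis by (simp add: arc_length_param_def t'_def)
qed

lemma arc_length_param_len: "t \<in> {a..b} \<Longrightarrow> arc_length_param a b \<gamma> (len t) = \<gamma> t"
  using sub_arc_length_param[of a b t] ab by simp

lemma continuous_on_arc_length_param: "continuous_on {0..len b} (arc_length_param a b \<gamma>)"
proof -
  have "dist (arc_length_param a b \<gamma> x) (arc_length_param a b \<gamma> y) \<le> dist x y"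
    if xy: "x \<in> {0..len b}" "y \<in> {0..len b}" for x y
  proof -
    obtain s t where "s \<in> {a..b}" "len s = x" "t \<in> {a..b}" "len t = y"
      using len_surj xy by metis
    then show ?thesis
      using dist_le_len[of s t] by (auto simp: arc_length_param_len dist_real_def abs_minus_commute)
  qed
  then show ?thesis
    unfolding continuous_on_iff by (meson le_less_trans)
qed

lemma borel_measurable_arc:
  assumes "\<rho> \<in> borel_measurable borel"
  shows "(\<lambda>s. \<rho> (arc_length_param a b \<gamma> s) * indicator {0..len b} s :: ennreal) \<in> borel_measurable borel"
proof -
  have "arc_length_param a b \<gamma> \<in> borel_measurable (restrict_space borel {0..len b})"
    by (intro borel_measurable_continuous_on_restrict continuous_on_arc_length_param)
  from measurable_compose[OF this assms] show ?thesis
    by (subst (asm) borel_measurable_restrict_space_iff_ennreal) auto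
qed

text \<open>
  Integrals over all subpaths are integrals over subintervals of one and the same parametrisation,
  so that they can be compared and are continuous in the endpoints. The indicator of the full
  parameter interval makes the integrand a Borel function on the whole line.
\<close>

lemma path_integral_sub:
  assumes cd: "a \<le> c" "c \<le> d" "d \<le> b" and \<rho>: "\<rho> \<in> borel_measurable borel"
  shows "path_integral (c, d, \<gamma>) \<rho>
    = (\<integral>\<^sup>+ s \<in> {len c..len d}. (\<rho> (arc_length_param a b \<gamma> s) * indicator {0..len b} s) \<partial>lborel)"
proof -
  define f where "f s = \<rho> (arc_length_param a b \<gamma> s) * indicator {0..len b} s * indicator {len c..len d} s" for s
  have l: "0 \<le> len c" "len c \<le> len d" "len d \<le> len b"
    using cd len_mono len_nonneg by auto
  have [measurable]: "f \<in> borel_measurable borel"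
    unfolding f_def using borel_measurable_arc[OF \<rho>] by simp
  have "path_integral (c, d, \<gamma>) \<rho>
    = (\<integral>\<^sup>+ s. \<rho> (arc_length_param c d \<gamma> s) * indicator {0..len d - len c} s \<partial>lborel)"
    using l cd by (simp add: path_integral_def nn_integral_completion curve_length_eq_len)
  also have "\<dots> = (\<integral>\<^sup>+ s. f (len c + 1 * s) \<partial>lborel)"
  proof (rule nn_integral_cong)
    fix s
    show "\<rho> (arc_length_param c d \<gamma> s) * indicator {0..len d - len c} s = f (len c + 1 * s)"
    proof (cases "s \<in> {0..len d - len c}")
      case True
      then have s: "len c + s \<in> {len c..len d}" by auto
      obtain t where t: "t \<in> {c..d}" "len t = len c + s"
      proof -
        have "continuous_on {c..d} len" using continuous_on_subset[OF continuous_on_len] cd by auto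
        then show ?thesis using IVT'[of len c "len c + s" d] cd s that by auto
      qed
      then have "arc_length_param c d \<gamma> s = arc_length_param a b \<gamma> (len c + s)"
        using sub_arc_length_param[OF cd t(1)] arc_length_param_len[of t] cd by auto
      then show ?thesis using True l by (auto simp: f_def indicator_def)
    next
      case False
      then show ?thesis by (auto simp: f_def indicator_def)
    qed
  qed
  also have "\<dots> = (\<integral>\<^sup>+ s. f s \<partial>lborel)"
    by (subst nn_integral_real_affine[of f 1 "len c"]) auto
  finally show ?thesis by (simp add: f_def)
qed

lemma path_integral_sub_le:
  assumes "a \<le> c" "c \<le> d" "d \<le> b" "\<rho> \<in> borel_measurable borel"
  shows "path_integral (c, d, \<gamma>) \<rho> \<le> path_integral (a, b, \<gamma>) \<rho>"
proof -
  have "0 \<le> len c" "len d \<le> len b" using assms len_mono len_nonneg by auto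
  then show ?thesis
    using assms ab by (auto simp: path_integral_sub intro!: nn_integral_mono split: split_indicator)
qed

text \<open>
  The endpoints are two parameters of arc length, hence a null set.
\<close>

lemma path_integral_mono_interior:
  assumes \<rho>: "\<rho> \<in> borel_measurable borel" "\<rho>' \<in> borel_measurable borel"
    and le: "\<And>t. a < t \<Longrightarrow> t < b \<Longrightarrow> \<rho> (\<gamma> t) \<le> \<rho>' (\<gamma> t)"
  shows "path_integral (a, b, \<gamma>) \<rho> \<le> path_integral (a, b, \<gamma>) \<rho>'"
  unfolding path_integral_sub[OF order_refl ab order_refl \<rho>(1)]
    path_integral_sub[OF order_refl ab order_refl \<rho>(2)]
proof (rule nn_integral_mono_AE)
  have "AE s in lborel. s \<noteq> 0" "AE s in lborel. s \<noteq> len b"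
    by (auto intro: AE_lborel_singleton)
  then show "AE s in lborel.
      \<rho> (arc_length_param a b \<gamma> s) * indicator {0..len b} s * indicator {len a..len b} s
      \<le> \<rho>' (arc_length_param a b \<gamma> s) * indicator {0..len b} s * indicator {len a..len b} s"
  proof eventually_elim
    case (elim s)
    show ?case
    proof (cases "s \<in> {0..len b}")
      case True
      then obtain t where t: "t \<in> {a..b}" "len t = s" by (rule len_surj)
      with elim have "t \<noteq> a" "t \<noteq> b" by auto
      then show ?thesis using t le[of t] by (auto simp: arc_length_param_len[of t, unfolded t(2)] split: split_indicator)
    qed auto
  qed
qed

end

section \<open>Powers of extended non-negative reals\<close>

lemma enn_powr_ennreal: "0 \<le> x \<Longrightarrow> enn_powr (ennreal x) a = ennreal (x powr a)"
  by (simp add: enn_powr_def)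

lemma enn_powr_top [simp]: "enn_powr top a = top"
  by (simp add: enn_powr_def)

lemma enn_powr_0 [simp]: "enn_powr 0 a = 0"
  by (simp add: enn_powr_def)

lemma enn_powr_mono: "0 \<le> a \<Longrightarrow> x \<le> y \<Longrightarrow> enn_powr x a \<le> enn_powr y a"
  by (cases x; cases y) (auto simp: enn_powr_ennreal top_unique intro!: ennreal_leI powr_mono2)

lemma enn_powr_times_indicator: "enn_powr (x * indicator A y) a = enn_powr x a * indicator A y"
  by (auto split: split_indicator)

lemma enn_powr_cmult:
  "0 < a \<Longrightarrow> 0 \<le> c \<Longrightarrow> enn_powr (ennreal c * x) a = ennreal (c powr a) * enn_powr x a"
  by (cases x; cases "c = 0")
     (auto simp: enn_powr_ennreal powr_mult ennreal_mult_top simp flip: ennreal_mult)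

lemma enn_powr_max_le: "enn_powr (max x y) a \<le> enn_powr x a + enn_powr y a"
  by (auto simp: max_def add_increasing add_increasing2)

lemma measurable_enn_powr [measurable (raw)]:
  assumes [measurable]: "f \<in> borel_measurable M"
  shows "(\<lambda>x. enn_powr (f x) a) \<in> borel_measurable M"
  unfolding enn_powr_def by measurable


section \<open>Borel majorants\<close>

locale metric_measure =
  fixes \<mu> :: "'a::metric_space set \<Rightarrow> ennreal"
  assumes borel_regular: "borel_regular_outer_measure \<mu>"
begin

abbreviation "M \<equiv> caratheodory_measure \<mu>"

lemma outer_measure_space: "outer_measure_space UNIV \<mu>"
  using borel_regular by (simp add: borel_regular_outer_measure_def)

lemma sets_borel_subset: "sets borel \<subseteq> sets M"
  using borel_regular sets_caratheodory_measure[OF outer_measure_space]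
  by (simp add: borel_regular_outer_measure_def)

lemma space_caratheodory [simp]: "space M = UNIV"
  by (simp add: caratheodory_measure_def space_measure_of_conv)

lemma sets_borelD [measurable_dest, intro]: "A \<in> sets borel \<Longrightarrow> A \<in> sets M"
  using sets_borel_subset by blast

lemma borel_measurableD [measurable_dest, intro]:
  "f \<in> borel_measurable borel \<Longrightarrow> f \<in> borel_measurable M"
  using sets_borel_subset by (auto simp: measurable_def)

lemma emeasure_eq: "A \<in> sets M \<Longrightarrow> emeasure M A = \<mu> A"
  using emeasure_caratheodory_measure[OF outer_measure_space] sets_caratheodory_measure[OF outer_measure_space]
  by simp

lemma outer_mono: "A \<subseteq> B \<Longrightarrow> \<mu> A \<le> \<mu> B"
  using outer_measure_space by (auto simp: outer_measure_space_def increasing_def)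

end

locale locally_finite_metric_measure = metric_measure +
  assumes finite_ball: "r > 0 \<Longrightarrow> \<mu> (ball x r) < \<infinity>"
begin

text \<open>
  Borel regularity gives Borel hulls of equal outer measure; the excess is a null set once the
  measure is finite, which holds on each of the balls that exhaust the space.
\<close>

lemma borel_superset:
  assumes A: "A \<in> sets M"
  obtains B where "B \<in> sets borel" "A \<subseteq> B" "B - A \<in> null_sets M"
proof -
  fix x0 :: 'a
  define An where "An n = A \<inter> ball x0 (real (Suc n))" for n :: nat
  have An: "An n \<in> sets M" for n
    unfolding An_def by (rule sets.Int[OF A sets_borelD]) simp
  have "\<exists>B\<in>sets borel. An n \<subseteq> B \<and> \<mu> B = \<mu> (An n)" for n
    using borel_regular by (simp add: borel_regular_outer_measure_def)
  then obtain Bn where Bn: "\<And>n. Bn n \<in> sets borel" "\<And>n. An n \<subseteq> Bn n" "\<And>n. \<mu> (Bn n) = \<mu> (An n)"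
    by metis
  have null: "Bn n - An n \<in> null_sets M" for n
  proof -
    have "\<mu> (An n) \<le> \<mu> (ball x0 (real (Suc n)))" by (rule outer_mono) (auto simp: An_def)
    then have fin: "\<mu> (An n) \<noteq> \<infinity>" using finite_ball[of "real (Suc n)" x0] by (auto simp: top_unique)
    have "emeasure M (Bn n - An n) = emeasure M (Bn n) - emeasure M (An n)"
      using Bn(1,2)[of n] An[of n] fin by (intro emeasure_Diff) (auto simp: emeasure_eq)
    also have "\<dots> = 0" using Bn(1,3)[of n] An[of n] fin by (simp add: emeasure_eq sets_borelD)
    finally show ?thesis using Bn(1)[of n] An[of n] by (auto simp: null_sets_def)
  qed
  show thesis
  proof
    show "(\<Union>n. Bn n) \<in> sets borel" using Bn(1) by auto
    show "A \<subseteq> (\<Union>n. Bn n)"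
    proof
      fix x assume x: "x \<in> A"
      obtain n where "dist x0 x < real n" using reals_Archimedean2 by blast
      then have "x \<in> An n" using x by (auto simp: An_def)
      then show "x \<in> (\<Union>n. Bn n)" using Bn(2) by blast
    qed
    have "(\<Union>n. Bn n - An n) \<in> null_sets M" using null by auto
    moreover have "(\<Union>n. Bn n) - A \<subseteq> (\<Union>n. Bn n - An n)" by (auto simp: An_def)
    moreover have "(\<Union>n. Bn n) - A \<in> sets M" using A Bn(1) by auto
    ultimately show "(\<Union>n. Bn n) - A \<in> null_sets M" by (metis null_sets_subset)
  qed
qed

text \<open>
  Built from Borel hulls of the countably many superlevel sets at rational heights. Being a
  majorant everywhere, and not only almost everywhere, it remains a weak upper gradient if the original function is one.
\<close>

lemma borel_majorant:
  fixes g :: "'a \<Rightarrow> ennreal"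
  assumes g: "g \<in> borel_measurable M"
  obtains g' where "g' \<in> borel_measurable borel" "\<And>x. g x \<le> g' x" "AE x in M. g' x = g x"
proof -
  have "\<exists>B. B \<in> sets borel \<and> {x. ennreal (real_of_rat r) < g x} \<subseteq> B
      \<and> B - {x. ennreal (real_of_rat r) < g x} \<in> null_sets M" for r
  proof -
    have "{x \<in> space M. ennreal (real_of_rat r) < g x} \<in> sets M" using g by measurable
    then show ?thesis by (auto elim!: borel_superset)
  qed
  then obtain B where B: "\<And>r. B r \<in> sets borel" "\<And>r. {x. ennreal (real_of_rat r) < g x} \<subseteq> B r"
      "\<And>r. B r - {x. ennreal (real_of_rat r) < g x} \<in> null_sets M"
    by metis
  define g' where "g' x = (SUP r. ennreal (real_of_rat r) * indicator (B r) x)" for x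
  have le: "g x \<le> g' x" for x
  proof (rule ccontr)
    assume "\<not> g x \<le> g' x"
    then obtain r where r: "g' x < ennreal (real_of_rat r)" "ennreal (real_of_rat r) < g x"
      using ennreal_rat_dense[of "g' x" "g x"] by (auto simp: not_le)
    then have "x \<in> B r" using B(2) by auto
    then have "ennreal (real_of_rat r) \<le> g' x"
      unfolding g'_def by (intro SUP_upper2[of r]) auto
    then show False using r by simp
  qed
  show thesis
  proof
    show "g' \<in> borel_measurable borel"
      unfolding g'_def using B(1) by (intro borel_measurable_SUP) auto
    show "g x \<le> g' x" for x by (rule le)
    have "(\<Union>r. B r - {x. ennreal (real_of_rat r) < g x}) \<in> null_sets M" using B(3) by auto
    then show "AE x in M. g' x = g x"
    proof (rule AE_I', safe)
      fix x assume ne: "g' x \<noteq> g x" 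
      then have "g x < g' x" using le[of x] by simp
      then obtain r where "g x < ennreal (real_of_rat r) * indicator (B r) x"
        unfolding g'_def less_SUP_iff by auto
      then have "x \<in> B r" "g x < ennreal (real_of_rat r)" by (auto split: split_indicator_asm)
      then show "x \<in> (\<Union>r. B r - {x. ennreal (real_of_rat r) < g x})" by (auto intro!: exI[of _ r])
    qed
  qed
qed

end


section \<open>Modulus\<close>

lemma path_integral_mono: "(\<And>x. \<rho> x \<le> \<rho>' x) \<Longrightarrow> path_integral c \<rho> \<le> path_integral c \<rho>'"
  unfolding path_integral_def by (auto split: prod.split intro!: nn_integral_mono mult_right_mono)

lemma rectifiable_curve_of_path: "is_path (a, b, \<gamma>) \<Longrightarrow> rectifiable_curve a b \<gamma>"
  by (auto simp: is_path_def rectifiable_curve_def)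

lemma almost_every_path_mono:
  assumes "almost_every_path \<mu> p P" "\<And>c. is_path c \<Longrightarrow> P c \<Longrightarrow> Q c"
  shows "almost_every_path \<mu> p Q"
  using assms unfolding almost_every_path_def zero_modulus_def by blast

text \<open>A path has at least the integral of any of its subpaths, so infinite integrals are inherited.\<close>

lemma almost_every_path_subpaths:
  assumes "almost_every_path \<mu> p P"
  shows "almost_every_path \<mu> p (\<lambda>(a, b, \<gamma>). \<forall>s t. a \<le> s \<and> s \<le> t \<and> t \<le> b \<and> is_path (s, t, \<gamma>) \<longrightarrow> P (s, t, \<gamma>))"
proof -
  obtain \<rho> where \<rho>: "\<rho> \<in> borel_measurable borel"
      "(\<integral>\<^sup>+ x. enn_powr (\<rho> x) p \<partial>caratheodory_measure \<mu>) < \<infinity>"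
      "\<And>c. is_path c \<Longrightarrow> \<not> P c \<Longrightarrow> path_integral c \<rho> = \<infinity>"
    using assms by (auto simp: almost_every_path_def zero_modulus_def)
  have "path_integral (a, b, \<gamma>) \<rho> = \<infinity>"
    if "is_path (a, b, \<gamma>)" "a \<le> s" "s \<le> t" "t \<le> b" "is_path (s, t, \<gamma>)" "\<not> P (s, t, \<gamma>)" for a b s t \<gamma>
    using rectifiable_curve.path_integral_sub_le[OF rectifiable_curve_of_path[OF that(1)] that(2-4) \<rho>(1)]
      \<rho>(3)[OF that(5,6)] by (simp add: top_unique)
  then show ?thesis
    using \<rho>(1,2) by (fastforce simp: almost_every_path_def zero_modulus_def)
qed

lemma almost_every_path_finite_integral:
  assumes "\<rho> \<in> borel_measurable borel" "(\<integral>\<^sup>+ x. enn_powr (\<rho> x) p \<partial>caratheodory_measure \<mu>) < \<infinity>"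
  shows "almost_every_path \<mu> p (\<lambda>c. path_integral c \<rho> < \<infinity>)"
  using assms unfolding almost_every_path_def zero_modulus_def
  by (intro bexI[of _ \<rho>]) (auto simp: less_top[symmetric])

lemma (in metric_measure) almost_every_path_conj:
  assumes "almost_every_path \<mu> p P" "almost_every_path \<mu> p Q"
  shows "almost_every_path \<mu> p (\<lambda>c. P c \<and> Q c)"
proof -
  obtain \<rho> where \<rho>[measurable]: "\<rho> \<in> borel_measurable borel"
      and \<rho>': "(\<integral>\<^sup>+ x. enn_powr (\<rho> x) p \<partial>M) < \<infinity>"
      "\<And>c. is_path c \<Longrightarrow> \<not> P c \<Longrightarrow> path_integral c \<rho> = \<infinity>"
    using assms(1) by (auto simp: almost_every_path_def zero_modulus_def)
  obtain \<sigma> where \<sigma>[measurable]: "\<sigma> \<in> borel_measurable borel"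
      and \<sigma>': "(\<integral>\<^sup>+ x. enn_powr (\<sigma> x) p \<partial>M) < \<infinity>"
      "\<And>c. is_path c \<Longrightarrow> \<not> Q c \<Longrightarrow> path_integral c \<sigma> = \<infinity>"
    using assms(2) by (auto simp: almost_every_path_def zero_modulus_def)
  have "(\<integral>\<^sup>+ x. enn_powr (max (\<rho> x) (\<sigma> x)) p \<partial>M)
      \<le> (\<integral>\<^sup>+ x. enn_powr (\<rho> x) p + enn_powr (\<sigma> x) p \<partial>M)"
    by (intro nn_integral_mono enn_powr_max_le)
  also have "\<dots> = (\<integral>\<^sup>+ x. enn_powr (\<rho> x) p \<partial>M) + (\<integral>\<^sup>+ x. enn_powr (\<sigma> x) p \<partial>M)"
    by (intro nn_integral_add measurable_enn_powr borel_measurableD \<rho> \<sigma>)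
  also have "\<dots> < \<infinity>" using \<rho>' \<sigma>' by simp
  finally have fin: "(\<integral>\<^sup>+ x. enn_powr (max (\<rho> x) (\<sigma> x)) p \<partial>M) < \<infinity>" .
  have "path_integral c (\<lambda>x. max (\<rho> x) (\<sigma> x)) = \<infinity>" if "is_path c" "\<not> (P c \<and> Q c)" for c
    using path_integral_mono[of \<rho> "\<lambda>x. max (\<rho> x) (\<sigma> x)" c]
      path_integral_mono[of \<sigma> "\<lambda>x. max (\<rho> x) (\<sigma> x)" c] \<rho>'(2)[of c] \<sigma>'(2)[of c] that
    by (auto simp: top_unique)
  then show ?thesis
    unfolding almost_every_path_def zero_modulus_def using fin
    by (intro bexI[of _ "\<lambda>x. max (\<rho> x) (\<sigma> x)"]) auto
qed


section \<open>Weak upper gradients of real-valued functions\<close>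

lemma weak_upper_gradient_real:
  "weak_upper_gradient \<mu> p (\<lambda>x. ereal (u x)) g \<longleftrightarrow>
     g \<in> borel_measurable (caratheodory_measure \<mu>) \<and>
     almost_every_path \<mu> p (\<lambda>(a, b, \<gamma>). ennreal \<bar>u (\<gamma> a) - u (\<gamma> b)\<bar> \<le> path_integral (a, b, \<gamma>) g)"
  by (simp add: weak_upper_gradient_def e2ennreal_ereal)

text \<open>
  Constant subpaths do not count as paths, but the inequality is trivial for them, so almost every path satisfies it on all of its
  subintervals.
\<close>

lemma weak_upper_gradient_subpaths:
  assumes "weak_upper_gradient \<mu> p (\<lambda>x. ereal (u x)) g"
  shows "almost_every_path \<mu> p (\<lambda>(a, b, \<gamma>).
    \<forall>s t. a \<le> s \<and> s \<le> t \<and> t \<le> b \<longrightarrow> ennreal \<bar>u (\<gamma> s) - u (\<gamma> t)\<bar> \<le> path_integral (s, t, \<gamma>) g)"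
proof -
  have "almost_every_path \<mu> p (\<lambda>(a, b, \<gamma>). ennreal \<bar>u (\<gamma> a) - u (\<gamma> b)\<bar> \<le> path_integral (a, b, \<gamma>) g)"
    using assms by (simp add: weak_upper_gradient_real)
  from almost_every_path_subpaths[OF this] show ?thesis
  proof (rule almost_every_path_mono, unfold split_paired_all prod.case, intro allI impI, elim conjE)
    fix a b \<gamma> s t
    assume path: "is_path (a, b, \<gamma>)" and st: "a \<le> s" "s \<le> t" "t \<le> b"
      and all: "\<forall>s t. a \<le> s \<and> s \<le> t \<and> t \<le> b \<and> is_path (s, t, \<gamma>) \<longrightarrow>
        ennreal \<bar>u (\<gamma> s) - u (\<gamma> t)\<bar> \<le> path_integral (s, t, \<gamma>) g"
    show "ennreal \<bar>u (\<gamma> s) - u (\<gamma> t)\<bar> \<le> path_integral (s, t, \<gamma>) g"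
    proof (cases "\<gamma> s = \<gamma> t")
      case False
      interpret rectifiable_curve s t \<gamma>
        using rectifiable_curve.sub[OF rectifiable_curve_of_path[OF path]] st by simp
      have "\<exists>x\<in>{s..t}. \<exists>y\<in>{s..t}. \<gamma> x \<noteq> \<gamma> y"
        using False st by (metis atLeastAtMost_iff order_refl)
      then have "is_path (s, t, \<gamma>)"
        using st finite_length cont by (simp add: is_path_def)
      then show ?thesis using all st by auto
    qed simp
  qed
qed

lemma (in locally_finite_metric_measure) borel_weak_upper_gradient:
  assumes wug: "weak_upper_gradient \<mu> p (\<lambda>x. ereal (u x)) g"
  obtains g' where "g' \<in> borel_measurable borel" "weak_upper_gradient \<mu> p (\<lambda>x. ereal (u x)) g'"
    "\<And>A. (\<integral>\<^sup>+ x \<in> A. enn_powr (g' x) p \<partial>M) = (\<integral>\<^sup>+ x \<in> A. enn_powr (g x) p \<partial>M)"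
proof -
  have "g \<in> borel_measurable M" using wug by (simp add: weak_upper_gradient_real)
  then obtain g' where g': "g' \<in> borel_measurable borel" "\<And>x. g x \<le> g' x" "AE x in M. g' x = g x"
    by (rule borel_majorant) blast
  show thesis
  proof
    show "g' \<in> borel_measurable borel" by fact
    have "almost_every_path \<mu> p (\<lambda>(a, b, \<gamma>). ennreal \<bar>u (\<gamma> a) - u (\<gamma> b)\<bar> \<le> path_integral (a, b, \<gamma>) g)"
      using wug by (simp add: weak_upper_gradient_real)
    then have "almost_every_path \<mu> p (\<lambda>(a, b, \<gamma>). ennreal \<bar>u (\<gamma> a) - u (\<gamma> b)\<bar> \<le> path_integral (a, b, \<gamma>) g')"
      by (rule almost_every_path_mono) (auto intro: order_trans[OF _ path_integral_mono[OF g'(2)]])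
    then show "weak_upper_gradient \<mu> p (\<lambda>x. ereal (u x)) g'"
      using g'(1) by (auto simp: weak_upper_gradient_real)
    show "(\<integral>\<^sup>+ x \<in> A. enn_powr (g' x) p \<partial>M) = (\<integral>\<^sup>+ x \<in> A. enn_powr (g x) p \<partial>M)" for A
      using g'(3) by (intro nn_integral_cong_AE) auto
  qed
qed

lemma path_integral_cmult:
  assumes "is_path c" "g \<in> borel_measurable borel"
  shows "path_integral c (\<lambda>x. ennreal k * g x) = ennreal k * path_integral c g"
proof -
  obtain a b \<gamma> where c: "c = (a, b, \<gamma>)" by (cases c)
  interpret rectifiable_curve a b \<gamma> using assms(1) unfolding c by (rule rectifiable_curve_of_path)
  define f where "f s = g (arc_length_param a b \<gamma> s) * indicator {0..len b} s * indicator {len a..len b} s" for s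
  have "f \<in> borel_measurable lborel"
    unfolding f_def using borel_measurable_arc[OF assms(2)] by simp
  then have "(\<integral>\<^sup>+ s. ennreal k * f s \<partial>lborel) = ennreal k * (\<integral>\<^sup>+ s. f s \<partial>lborel)"
    by (rule nn_integral_cmult)
  then show ?thesis unfolding c
    using ab assms(2) by (simp add: path_integral_sub f_def mult.assoc)
qed

lemma (in metric_measure) weak_upper_gradient_lipschitz_comp:
  assumes wug: "weak_upper_gradient \<mu> p (\<lambda>x. ereal (u x)) g" and g: "g \<in> borel_measurable borel"
    and le: "\<And>x y. \<bar>v x - v y\<bar> \<le> k * \<bar>u x - u y\<bar>" and k: "k \<ge> 0"
  shows "weak_upper_gradient \<mu> p (\<lambda>x. ereal (v x)) (\<lambda>x. ennreal k * g x)"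
  unfolding weak_upper_gradient_real
proof
  show "(\<lambda>x. ennreal k * g x) \<in> borel_measurable M" using g by (intro borel_measurableD) simp
  have "almost_every_path \<mu> p (\<lambda>(a, b, \<gamma>). ennreal \<bar>u (\<gamma> a) - u (\<gamma> b)\<bar> \<le> path_integral (a, b, \<gamma>) g)"
    using wug by (simp add: weak_upper_gradient_real)
  then show "almost_every_path \<mu> p (\<lambda>(a, b, \<gamma>). ennreal \<bar>v (\<gamma> a) - v (\<gamma> b)\<bar>
      \<le> path_integral (a, b, \<gamma>) (\<lambda>x. ennreal k * g x))"
  proof (rule almost_every_path_mono, clarify)
    fix a b \<gamma> assume path: "is_path (a, b, \<gamma>)"
      and *: "ennreal \<bar>u (\<gamma> a) - u (\<gamma> b)\<bar> \<le> path_integral (a, b, \<gamma>) g"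
    have "ennreal \<bar>v (\<gamma> a) - v (\<gamma> b)\<bar> \<le> ennreal k * ennreal \<bar>u (\<gamma> a) - u (\<gamma> b)\<bar>"
      using le k by (simp flip: ennreal_mult add: ennreal_leI)
    also have "\<dots> \<le> ennreal k * path_integral (a, b, \<gamma>) g"
      using * by (rule mult_left_mono) simp
    finally show "ennreal \<bar>v (\<gamma> a) - v (\<gamma> b)\<bar> \<le> path_integral (a, b, \<gamma>) (\<lambda>x. ennreal k * g x)"
      by (simp add: path_integral_cmult[OF path g])
  qed
qed

lemma (in metric_measure) weak_upper_gradient_max:
  assumes "weak_upper_gradient \<mu> p (\<lambda>x. ereal (u x)) g" and g: "g \<in> borel_measurable borel"
    and "weak_upper_gradient \<mu> p (\<lambda>x. ereal (v x)) h" and h: "h \<in> borel_measurable borel"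
  shows "weak_upper_gradient \<mu> p (\<lambda>x. ereal (max (u x) (v x))) (\<lambda>x. max (g x) (h x))"
  unfolding weak_upper_gradient_real
proof
  show "(\<lambda>x. max (g x) (h x)) \<in> borel_measurable M" using g h by (intro borel_measurableD) simp
  have "almost_every_path \<mu> p (\<lambda>c. (case c of (a, b, \<gamma>) \<Rightarrow> ennreal \<bar>u (\<gamma> a) - u (\<gamma> b)\<bar> \<le> path_integral (a, b, \<gamma>) g)
     \<and> (case c of (a, b, \<gamma>) \<Rightarrow> ennreal \<bar>v (\<gamma> a) - v (\<gamma> b)\<bar> \<le> path_integral (a, b, \<gamma>) h))"
    using assms by (intro almost_every_path_conj) (auto simp: weak_upper_gradient_real)
  then show "almost_every_path \<mu> p (\<lambda>(a, b, \<gamma>). ennreal \<bar>max (u (\<gamma> a)) (v (\<gamma> a)) - max (u (\<gamma> b)) (v (\<gamma> b))\<bar>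
      \<le> path_integral (a, b, \<gamma>) (\<lambda>x. max (g x) (h x)))"
  proof (rule almost_every_path_mono, clarify)
    fix a b \<gamma>
    assume *: "ennreal \<bar>u (\<gamma> a) - u (\<gamma> b)\<bar> \<le> path_integral (a, b, \<gamma>) g"
      "ennreal \<bar>v (\<gamma> a) - v (\<gamma> b)\<bar> \<le> path_integral (a, b, \<gamma>) h"
    have "\<bar>max (u (\<gamma> a)) (v (\<gamma> a)) - max (u (\<gamma> b)) (v (\<gamma> b))\<bar> \<le> max \<bar>u (\<gamma> a) - u (\<gamma> b)\<bar> \<bar>v (\<gamma> a) - v (\<gamma> b)\<bar>"
      by linarith
    then have "ennreal \<bar>max (u (\<gamma> a)) (v (\<gamma> a)) - max (u (\<gamma> b)) (v (\<gamma> b))\<bar>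
        \<le> max (ennreal \<bar>u (\<gamma> a) - u (\<gamma> b)\<bar>) (ennreal \<bar>v (\<gamma> a) - v (\<gamma> b)\<bar>)"
      by (auto simp: max_def ennreal_leI split: if_splits)
    also have "\<dots> \<le> path_integral (a, b, \<gamma>) (\<lambda>x. max (g x) (h x))"
      by (intro max.boundedI order_trans[OF *(1)] order_trans[OF *(2)] path_integral_mono) auto
    finally show "ennreal \<bar>max (u (\<gamma> a)) (v (\<gamma> a)) - max (u (\<gamma> b)) (v (\<gamma> b))\<bar>
        \<le> path_integral (a, b, \<gamma>) (\<lambda>x. max (g x) (h x))" .
  qed
qed

section \<open>Truncation and localisation of weak upper gradients\<close>

text \<open>
  The integral of \<open>g\<close> along the path up to arc length \<open>s\<close> is the distribution function of a
  finite measure without atoms, hence continuous in \<open>s\<close>, and it controls the oscillation of \<open>w\<close>.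
\<close>

lemma (in rectifiable_curve) continuous_on_of_path_integral_bound:
  fixes w :: "real \<Rightarrow> real"
  assumes g: "g \<in> borel_measurable borel" and fin: "path_integral (a, b, \<gamma>) g < \<infinity>"
    and le: "\<And>s t. a \<le> s \<Longrightarrow> s \<le> t \<Longrightarrow> t \<le> b \<Longrightarrow> ennreal \<bar>w s - w t\<bar> \<le> path_integral (s, t, \<gamma>) g"
  shows "continuous_on {a..b} w"
proof -
  define f where "f s = g (arc_length_param a b \<gamma> s) * indicator {0..len b} s" for s
  have [measurable]: "f \<in> borel_measurable borel"
    unfolding f_def using borel_measurable_arc[OF g] by simp
  define N where "N = density lborel f"
  have emeasure_N: "emeasure N A = (\<integral>\<^sup>+ s. f s * indicator A s \<partial>lborel)" if "A \<in> sets borel" for A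
    unfolding N_def using that by (intro emeasure_density) auto
  have "emeasure N UNIV = (\<integral>\<^sup>+ s. f s * indicator {len a..len b} s \<partial>lborel)"
    by (subst emeasure_N) (auto simp: f_def intro!: nn_integral_cong split: split_indicator)
  also have "\<dots> = path_integral (a, b, \<gamma>) g"
    by (simp add: path_integral_sub[OF order_refl ab order_refl g] f_def)
  finally have "emeasure N (space N) \<noteq> \<infinity>"
    using fin by (simp add: N_def)
  then interpret N: finite_measure N by (rule finite_measureI)
  interpret N: finite_borel_measure N by unfold_locales (simp add: N_def)
  have point: "emeasure N {x} = 0" for x
  proof -
    have "AE s in lborel. s \<noteq> x" by (rule AE_lborel_singleton)
    then have "AE s in lborel. f s * indicator {x} s = 0" by eventually_elim simp
    then show ?thesis by (simp add: emeasure_N nn_integral_0_iff_AE)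
  qed
  have measure_point: "Sigma_Algebra.measure N {x} = 0" for x
    by (simp add: Sigma_Algebra.measure_def point)
  have bound: "\<bar>w s - w t\<bar> \<le> cdf N (len t) - cdf N (len s)" if st: "a \<le> s" "s \<le> t" "t \<le> b" for s t
  proof -
    have l: "len s \<le> len t" using len_mono st by auto
    have "ennreal \<bar>w s - w t\<bar> \<le> emeasure N {len s..len t}"
      using le[OF st] path_integral_sub[OF st g] by (simp add: emeasure_N f_def)
    also have "{len s..len t} = {len s} \<union> {len s<..len t}" using l by auto
    also have "emeasure N \<dots> \<le> emeasure N {len s} + emeasure N {len s<..len t}"
      by (intro emeasure_subadditive) (auto simp: N_def)
    also have "\<dots> = ennreal (cdf N (len t) - cdf N (len s))"
      using l by (cases "len s = len t") (auto simp: measure_point point N.cdf_diff_eq N.emeasure_eq_measure)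
    finally show ?thesis using N.cdf_nondecreasing[OF l] by simp
  qed
  have "continuous_on UNIV (cdf N)"
    by (intro continuous_at_imp_continuous_on ballI) (simp add: N.isCont_cdf measure_point)
  then have cont: "continuous_on {a..b} (\<lambda>t. cdf N (len t))"
    by (rule continuous_on_compose2) (auto intro: continuous_on_len)
  have "dist (w s) (w t) \<le> dist (cdf N (len s)) (cdf N (len t))" if "s \<in> {a..b}" "t \<in> {a..b}" for s t
    using bound[of s t] bound[of t s] that by (cases "s \<le> t") (auto simp: dist_real_def abs_minus_commute)
  then show ?thesis
    using cont unfolding continuous_on_iff by (meson le_less_trans)
qed

text \<open>Take the first time \<open>t\<close> at which \<open>w\<close> reaches \<open>B\<close>, and the last time before it at which \<open>w \<le> A\<close>.\<close>

lemma crossing_interval: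
  fixes w :: "real \<Rightarrow> real"
  assumes cont: "continuous_on {a..b} w" and ab: "a \<le> b" and A: "w a \<le> A" and AB: "A < B" and B: "B \<le> w b"
  obtains s t where "a \<le> s" "s < t" "t \<le> b" "w s = A" "w t = B"
    "\<And>r. s < r \<Longrightarrow> r < t \<Longrightarrow> A < w r \<and> w r < B"
proof -
  define T where "T = {r \<in> {a..b}. B \<le> w r}"
  define t where "t = Inf T"
  have "closed T" unfolding T_def
    by (rule continuous_on_closed_Collect_le) (auto intro: cont continuous_intros)
  moreover have "T \<noteq> {}" "bdd_below T" using ab B by (auto simp: T_def bdd_below_def)
  ultimately have tT: "t \<in> T" unfolding t_def by (intro closed_contains_Inf)
  have t_le: "t \<le> r" if "r \<in> T" for r
    unfolding t_def using that \<open>bdd_below T\<close> by (rule cInf_lower)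
  have t: "a \<le> t" "t \<le> b" "B \<le> w t" using tT by (auto simp: T_def)
  have contt: "continuous_on {a..t} w" using cont t by (auto intro: continuous_on_subset)
  obtain r where "r \<in> {a..t}" "w r = B" using IVT'[of w a B t] A AB t contt by auto
  then have wt: "w t = B" using t_le[of r] t by (auto simp: T_def)
  define S where "S = {r \<in> {a..t}. w r \<le> A}"
  define s where "s = Sup S"
  have "closed S" unfolding S_def
    by (rule continuous_on_closed_Collect_le) (auto intro: contt continuous_intros)
  moreover have "S \<noteq> {}" "bdd_above S" using t A by (auto simp: S_def bdd_above_def)
  ultimately have sS: "s \<in> S" unfolding s_def by (intro closed_contains_Sup)
  have le_s: "r \<le> s" if "r \<in> S" for r
    unfolding s_def using that \<open>bdd_above S\<close> by (rule cSup_upper)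
  have s: "a \<le> s" "s \<le> t" "w s \<le> A" using sS by (auto simp: S_def)
  have conts: "continuous_on {s..t} w" using contt s by (auto intro: continuous_on_subset)
  obtain r where "r \<in> {s..t}" "w r = A" using IVT'[of w s A t] AB s wt conts by auto
  then have ws: "w s = A" using le_s[of r] s by (auto simp: S_def)
  show thesis
  proof
    show "a \<le> s" "t \<le> b" "w s = A" "w t = B" by fact+
    show "s < t" using s ws wt AB by (cases "s = t") auto
    fix r assume r: "s < r" "r < t"
    show "A < w r \<and> w r < B"
      using le_s[of r] t_le[of r] r s t by (force simp: S_def T_def)
  qed
qed

text \<open>
  This is how gradients are localised to a region \<open>S\<close>: it suffices to find a subpath with interior
  in \<open>S\<close> over which the function has the required increment.
\<close>

lemma path_integral_indicator_bound:
  assumes path: "is_path (a, b, \<gamma>)" and g: "g \<in> borel_measurable borel" and S: "S \<in> sets borel"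
    and st: "a \<le> s" "s \<le> t" "t \<le> b" and inside: "\<And>r. s < r \<Longrightarrow> r < t \<Longrightarrow> \<gamma> r \<in> S"
  shows "path_integral (s, t, \<gamma>) g \<le> path_integral (a, b, \<gamma>) (\<lambda>x. g x * indicator S x)"
proof -
  interpret rectifiable_curve a b \<gamma> using path by (rule rectifiable_curve_of_path)
  have gS: "(\<lambda>x. g x * indicator S x) \<in> borel_measurable borel" using g S by simp
  have "path_integral (s, t, \<gamma>) g \<le> path_integral (s, t, \<gamma>) (\<lambda>x. g x * indicator S x)"
    by (rule rectifiable_curve.path_integral_mono_interior[OF sub[OF st] g gS]) (simp add: inside)
  also have "\<dots> \<le> path_integral (a, b, \<gamma>) (\<lambda>x. g x * indicator S x)"
    by (rule path_integral_sub_le[OF st gS])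
  finally show ?thesis .
qed

text \<open>
  If a path leaves \<open>\<Omega>\<close>, the pieces before its first exit and after its last one start or end at a
  zero of \<open>u\<close>. Each of them alone controls the value of \<open>u\<close> at its other end, and
  as \<open>u \<ge> 0\<close> the larger of the two values dominates the increment over the whole path.
\<close>

lemma (in metric_measure) weak_upper_gradient_restrict:
  assumes wug: "weak_upper_gradient \<mu> p (\<lambda>x. ereal (u x)) g" and g: "g \<in> borel_measurable borel"
    and \<Omega>: "open \<Omega>" and nonneg: "\<And>x. 0 \<le> u x" and zero: "\<And>x. x \<notin> \<Omega> \<Longrightarrow> u x = 0"
  shows "weak_upper_gradient \<mu> p (\<lambda>x. ereal (u x)) (\<lambda>x. g x * indicator \<Omega> x)"
  unfolding weak_upper_gradient_real
proof
  show "(\<lambda>x. g x * indicator \<Omega> x) \<in> borel_measurable M"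
    using g \<Omega> by (intro borel_measurableD) simp
  show "almost_every_path \<mu> p (\<lambda>(a, b, \<gamma>). ennreal \<bar>u (\<gamma> a) - u (\<gamma> b)\<bar>
      \<le> path_integral (a, b, \<gamma>) (\<lambda>x. g x * indicator \<Omega> x))"
    using weak_upper_gradient_subpaths[OF wug]
  proof (rule almost_every_path_mono, clarify)
    fix a b \<gamma> assume path: "is_path (a, b, \<gamma>)"
      and bound: "\<forall>s t. a \<le> s \<and> s \<le> t \<and> t \<le> b \<longrightarrow> ennreal \<bar>u (\<gamma> s) - u (\<gamma> t)\<bar> \<le> path_integral (s, t, \<gamma>) g"
    define I where "I = path_integral (a, b, \<gamma>) (\<lambda>x. g x * indicator \<Omega> x)"
    interpret rectifiable_curve a b \<gamma> using path by (rule rectifiable_curve_of_path)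
    have key: "ennreal \<bar>u (\<gamma> s) - u (\<gamma> t)\<bar> \<le> I"
      if st: "a \<le> s" "s \<le> t" "t \<le> b" and inside: "\<And>r. s < r \<Longrightarrow> r < t \<Longrightarrow> \<gamma> r \<in> \<Omega>" for s t
    proof -
      have "ennreal \<bar>u (\<gamma> s) - u (\<gamma> t)\<bar> \<le> path_integral (s, t, \<gamma>) g"
        using bound[rule_format, of s t] st by simp
      also have "\<dots> \<le> I" unfolding I_def
        using \<Omega> by (intro path_integral_indicator_bound[OF path g _ st] inside) auto
      finally show ?thesis .
    qed
    define Z where "Z = {r \<in> {a..b}. \<gamma> r \<notin> \<Omega>}"
    show "ennreal \<bar>u (\<gamma> a) - u (\<gamma> b)\<bar> \<le> I"
    proof (cases "Z = {}")
      case True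
      then show ?thesis using ab by (intro key) (auto simp: Z_def)
    next
      case False
      have "closed ({a..b} \<inter> \<gamma> -` (- \<Omega>))"
        using cont \<Omega> by (intro continuous_closed_preimage) auto
      moreover have "{a..b} \<inter> \<gamma> -` (- \<Omega>) = Z" by (auto simp: Z_def)
      ultimately have "closed Z" by simp
      have bdd: "bdd_below Z" "bdd_above Z" by (auto simp: Z_def bdd_below_def bdd_above_def)
      have Inf: "Inf Z \<in> Z" using closed_contains_Inf[OF False bdd(1) \<open>closed Z\<close>] .
      have Sup: "Sup Z \<in> Z" using closed_contains_Sup[OF False bdd(2) \<open>closed Z\<close>] .
      have "\<gamma> r \<in> \<Omega>" if "a < r" "r < Inf Z" for r
        using that Inf cInf_lower[OF _ bdd(1), of r] by (force simp: Z_def)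
      then have "ennreal \<bar>u (\<gamma> a) - u (\<gamma> (Inf Z))\<bar> \<le> I"
        using Inf by (intro key) (auto simp: Z_def)
      then have 1: "ennreal (u (\<gamma> a)) \<le> I" using Inf zero nonneg by (simp add: Z_def)
      have "\<gamma> r \<in> \<Omega>" if "Sup Z < r" "r < b" for r
        using that Sup cSup_upper[OF _ bdd(2), of r] by (force simp: Z_def)
      then have "ennreal \<bar>u (\<gamma> (Sup Z)) - u (\<gamma> b)\<bar> \<le> I"
        using Sup by (intro key) (auto simp: Z_def)
      then have 2: "ennreal (u (\<gamma> b)) \<le> I" using Sup zero nonneg by (simp add: Z_def)
      have "\<bar>u (\<gamma> a) - u (\<gamma> b)\<bar> \<le> u (\<gamma> a) \<or> \<bar>u (\<gamma> a) - u (\<gamma> b)\<bar> \<le> u (\<gamma> b)"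
        using nonneg[of "\<gamma> a"] nonneg[of "\<gamma> b"] by linarith
      then show ?thesis using 1 2 by (meson ennreal_leI order_trans)
    qed
  qed
qed

text \<open>
  As \<open>g\<close> has finite energy, its integral over almost every path is finite, and \<open>u\<close> is continuous
  along such a path. The increment of the truncation is then the increment of \<open>u\<close> over a crossing
  between two levels in \<open>[A, B]\<close>, whose interior lies in the slice. Continuity along
  the path has to come from \<open>g\<close>, as the functions of interest are continuous only on \<open>\<Omega>\<close>.
\<close>

lemma (in metric_measure) weak_upper_gradient_truncate:
  assumes wug: "weak_upper_gradient \<mu> p (\<lambda>x. ereal (u x)) g" and g: "g \<in> borel_measurable borel"
    and fin: "(\<integral>\<^sup>+ x. enn_powr (g x) p \<partial>M) < \<infinity>" and u: "u \<in> borel_measurable borel"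
  shows "weak_upper_gradient \<mu> p (\<lambda>x. ereal (min B (max A (u x))))
    (\<lambda>x. g x * indicator {x. A < u x \<and> u x < B} x)"
  unfolding weak_upper_gradient_real
proof
  define S where "S = {x. A < u x \<and> u x < B}"
  have "{x \<in> space borel. A < u x \<and> u x < B} \<in> sets borel" using u by measurable
  then have S: "S \<in> sets borel" by (simp add: S_def)
  show "(\<lambda>x. g x * indicator {x. A < u x \<and> u x < B} x) \<in> borel_measurable M"
    using g S by (intro borel_measurableD) (simp add: S_def)
  define v where "v x = min B (max A (u x))" for x
  have ae: "almost_every_path \<mu> p (\<lambda>c. (case c of (a, b, \<gamma>) \<Rightarrow>
      \<forall>s t. a \<le> s \<and> s \<le> t \<and> t \<le> b \<longrightarrow> ennreal \<bar>u (\<gamma> s) - u (\<gamma> t)\<bar> \<le> path_integral (s, t, \<gamma>) g)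
      \<and> path_integral c g < \<infinity>)"
    by (intro almost_every_path_conj weak_upper_gradient_subpaths[OF wug]
        almost_every_path_finite_integral g fin)
  have "almost_every_path \<mu> p (\<lambda>(a, b, \<gamma>). ennreal \<bar>v (\<gamma> a) - v (\<gamma> b)\<bar>
      \<le> path_integral (a, b, \<gamma>) (\<lambda>x. g x * indicator S x))"
    using ae
  proof (rule almost_every_path_mono, clarify)
    fix a b \<gamma> assume path: "is_path (a, b, \<gamma>)" and pfin: "path_integral (a, b, \<gamma>) g < \<infinity>"
      and bound: "\<forall>s t. a \<le> s \<and> s \<le> t \<and> t \<le> b \<longrightarrow> ennreal \<bar>u (\<gamma> s) - u (\<gamma> t)\<bar> \<le> path_integral (s, t, \<gamma>) g"
    interpret rectifiable_curve a b \<gamma> using path by (rule rectifiable_curve_of_path)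
    have cont: "continuous_on {a..b} (\<lambda>t. u (\<gamma> t))"
      using bound by (intro continuous_on_of_path_integral_bound[OF g pfin]) auto
    define I where "I = path_integral (a, b, \<gamma>) (\<lambda>x. g x * indicator S x)"
    have key: "ennreal \<bar>u (\<gamma> s) - u (\<gamma> t)\<bar> \<le> I"
      if st: "a \<le> s" "s \<le> t" "t \<le> b" and inside: "\<And>r. s < r \<Longrightarrow> r < t \<Longrightarrow> \<gamma> r \<in> S" for s t
      using order_trans[OF bound[rule_format, of s t] path_integral_indicator_bound[OF path g S st inside]] st
      unfolding I_def by blast
    consider "v (\<gamma> a) = v (\<gamma> b)" | "v (\<gamma> a) < v (\<gamma> b)" | "v (\<gamma> b) < v (\<gamma> a)" by linarith
    then show "ennreal \<bar>v (\<gamma> a) - v (\<gamma> b)\<bar> \<le> I"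
    proof cases
      case 2
      obtain s t where "a \<le> s" "s < t" "t \<le> b" and eq: "u (\<gamma> s) = v (\<gamma> a)" "u (\<gamma> t) = v (\<gamma> b)"
        and btw: "\<And>r. s < r \<Longrightarrow> r < t \<Longrightarrow> v (\<gamma> a) < u (\<gamma> r) \<and> u (\<gamma> r) < v (\<gamma> b)"
        using crossing_interval[of a b "\<lambda>t. u (\<gamma> t)" "v (\<gamma> a)" "v (\<gamma> b)"] cont ab 2
        by (auto simp: v_def min_def max_def split: if_splits)
      moreover have "A \<le> v (\<gamma> a)" "v (\<gamma> b) \<le> B" using 2 by (auto simp: v_def min_def max_def split: if_splits)
      ultimately have "ennreal \<bar>u (\<gamma> s) - u (\<gamma> t)\<bar> \<le> I"
        by (intro key) (force simp: S_def)+
      then show ?thesis by (simp add: eq)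
    next
      \<comment> \<open>A downward crossing is an upward crossing of \<open>- u\<close>.\<close>
      case 3
      have "continuous_on {a..b} (\<lambda>t. - u (\<gamma> t))" using cont by (rule continuous_on_minus)
      then obtain s t where "a \<le> s" "s < t" "t \<le> b" and eq: "- u (\<gamma> s) = - v (\<gamma> a)" "- u (\<gamma> t) = - v (\<gamma> b)"
        and btw: "\<And>r. s < r \<Longrightarrow> r < t \<Longrightarrow> - v (\<gamma> a) < - u (\<gamma> r) \<and> - u (\<gamma> r) < - v (\<gamma> b)"
        using crossing_interval[of a b "\<lambda>t. - u (\<gamma> t)" "- v (\<gamma> a)" "- v (\<gamma> b)"] ab 3
        by (auto simp: v_def min_def max_def split: if_splits)
      moreover have "A \<le> v (\<gamma> b)" "v (\<gamma> a) \<le> B" using 3 by (auto simp: v_def min_def max_def split: if_splits)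
      ultimately have "ennreal \<bar>u (\<gamma> s) - u (\<gamma> t)\<bar> \<le> I"
        by (intro key) (force simp: S_def)+
      then show ?thesis using eq by simp
    qed simp
  qed
  then show "almost_every_path \<mu> p (\<lambda>(a, b, \<gamma>). ennreal \<bar>min B (max A (u (\<gamma> a))) - min B (max A (u (\<gamma> b)))\<bar>
      \<le> path_integral (a, b, \<gamma>) (\<lambda>x. g x * indicator {x. A < u x \<and> u x < B} x))"
    by (simp add: v_def S_def)
qed

section \<open>The capacity profile\<close>

lemma inverse_antimono_ennreal: "y \<le> z \<Longrightarrow> inverse z \<le> inverse (y :: ennreal)"
  by (cases y; cases z; cases "y = 0")
     (auto simp: inverse_ennreal top_unique le_imp_inverse_le less_le intro!: ennreal_leI)

lemma divide_left_mono_ennreal: "y \<le> z \<Longrightarrow> x / z \<le> x / (y :: ennreal)"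
  unfolding divide_ennreal_def by (intro mult_left_mono inverse_antimono_ennreal) auto

lemma upward_closed_real_borel:
  fixes S :: "real set"
  assumes up: "\<And>x y. x \<in> S \<Longrightarrow> x \<le> y \<Longrightarrow> y \<in> S"
  shows "S \<in> sets borel"
proof -
  consider "S = {}" | "S \<noteq> {}" "\<not> bdd_below S" | "S \<noteq> {}" "bdd_below S" by argo
  then show ?thesis
  proof cases
    case 2
    have "x \<in> S" for x
      using 2(2) up unfolding bdd_below_def by (metis linear)
    then have "S = UNIV" by blast
    then show ?thesis by simp
  next
    case 3
    have "{Inf S<..} \<subseteq> S" using up cInf_less_iff[OF 3] by (meson greaterThan_iff less_imp_le subsetI)
    moreover have "S \<subseteq> {Inf S..}" using 3 by (auto intro: cInf_lower)
    ultimately have "S = {Inf S<..} \<or> S = {Inf S..}" by (force simp: less_le)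
    then show ?thesis by (metis borel_closed borel_open closed_atLeast open_greaterThan)
  qed simp
qed

locale capacity_setting = locally_finite_metric_measure \<mu> + N: metric_measure \<nu>
  for \<mu> \<nu> :: "'a::metric_space set \<Rightarrow> ennreal" +
  fixes \<Omega> :: "'a set" and p q :: real
  assumes open_domain: "open \<Omega>" and one_le_q: "1 \<le> q" and q_less_p: "q < p"
begin

abbreviation profile :: "real \<Rightarrow> ennreal" where
  "profile \<equiv> capacity_profile \<mu> \<nu> p \<Omega>"

definition integrand :: "real \<Rightarrow> ennreal" where
  "integrand t = enn_powr (ennreal (t powr (p / q)) / profile t) (q / (p - q)) / ennreal t"

definition profile_integral :: ennreal where
  "profile_integral = (\<integral>\<^sup>+ t \<in> {t. 0 < t \<and> ennreal t < \<nu> \<Omega>}. integrand t \<partial>lborel)"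

lemma profile_mono: "s \<le> t \<Longrightarrow> profile s \<le> profile t"
  unfolding capacity_profile_def
  by (rule INF_superset_mono) (auto intro: order_trans[OF ennreal_leI])

lemma profile_le_capacity: "G \<subseteq> \<Omega> \<Longrightarrow> ennreal t \<le> \<nu> G \<Longrightarrow> profile t \<le> variational_capacity \<mu> p G \<Omega>"
  unfolding capacity_profile_def by (rule INF_lower) simp

lemma profile_measurable [measurable]: "profile \<in> borel_measurable borel"
  by (rule borel_measurableI_greater)
     (auto intro!: upward_closed_real_borel intro: less_le_trans[OF _ profile_mono])

lemma integrand_measurable [measurable]: "integrand \<in> borel_measurable borel"
  unfolding integrand_def by measurable

lemma variational_capacity_le:
  assumes "continuous_on \<Omega> u" "\<And>x. x \<in> E \<Longrightarrow> u x = 1" "\<And>x. x \<notin> \<Omega> \<Longrightarrow> u x = 0"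
    and "weak_upper_gradient \<mu> p (\<lambda>x. ereal (u x)) g"
  shows "variational_capacity \<mu> p E \<Omega> \<le> (\<integral>\<^sup>+ x \<in> \<Omega>. enn_powr (g x) p \<partial>M)"
  unfolding variational_capacity_def by (rule INF_lower2[of "(u, g)"]) (use assms in auto)

lemma borel_measurable_of_continuous_on_domain:
  fixes u :: "'a \<Rightarrow> real"
  assumes "continuous_on \<Omega> u" "\<And>x. x \<notin> \<Omega> \<Longrightarrow> u x = 0"
  shows "u \<in> borel_measurable borel"
proof -
  have "(\<lambda>x. if x \<in> \<Omega> then u x else 0) \<in> borel_measurable borel"
    using open_domain assms(1) by (intro borel_measurable_continuous_on_if) auto
  moreover have "(\<lambda>x. if x \<in> \<Omega> then u x else 0) = u" using assms(2) by auto
  ultimately show ?thesis by simp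
qed


section \<open>Finite profile integral implies the Sobolev inequality\<close>

text \<open>
  This takes the place of Young's and Hoelder's inequalities. Let \<open>d = b - a\<close>. Either
  \<open>x\<^sup>q d \<le> x\<^sup>p c\<close>, or \<open>c\<close> and with it the profile on the interval is less than \<open>m = d x\<^sup>q\<^sup>-\<^sup>p\<close>. In the
  latter case \<open>t \<ge> d / 2\<close> on the upper half of the interval, where the integrand is therefore at
  least \<open>(t / m)\<^sup>\<beta> \<ge> 2\<^sup>-\<^sup>\<beta> x\<^sup>q\<close> with \<open>\<beta> = q / (p - q)\<close>; the exponent \<open>p / (p - q) = 1 + \<beta>\<close> of the constant
  also makes up for the loss of half the interval.
\<close>

lemma level_dichotomy:
  assumes x: "0 < x" and a: "0 \<le> a" "a < b" and le: "\<And>t. a < t \<Longrightarrow> t < b \<Longrightarrow> profile t \<le> c"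
  shows "ennreal (x powr q * (b - a)) \<le> ennreal (x powr p) * c
    + ennreal (2 powr (p / (p - q))) * (\<integral>\<^sup>+ t \<in> {a<..<b}. integrand t \<partial>lborel)"
proof (cases c)
  case top
  then show ?thesis using x by (simp add: ennreal_mult_top)
next
  case (real c0)
  define d where "d = b - a"
  define \<beta> where "\<beta> = q / (p - q)"
  have d: "0 < d" using a by (simp add: d_def)
  have \<beta>: "0 < \<beta>" using one_le_q q_less_p by (simp add: \<beta>_def)
  show ?thesis
  proof (cases "x powr q * d \<le> x powr p * c0")
    case True
    then have "ennreal (x powr q * (b - a)) \<le> ennreal (x powr p) * c"
      using real by (simp add: d_def ennreal_leI flip: ennreal_mult)
    then show ?thesis by (rule add_increasing2[rotated]) simp
  next
    case False
    define m where "m = d * x powr (q - p)"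
    have m: "0 < m" using d x by (simp add: m_def)
    have "c0 * x powr p < m * x powr p"
      using False x by (simp add: m_def algebra_simps flip: powr_add)
    then have cm: "c0 \<le> m" using x by (simp add: mult_less_cancel_right)
    have low: "ennreal (2 powr - \<beta> * x powr q) \<le> integrand t" if t: "a + d / 2 < t" "t < b" for t
    proof -
      have t0: "d / 2 \<le> t" "0 < t" "a < t" using t a d by auto
      have "profile t \<le> ennreal c0" using le[OF t0(3) t(2)] real by simp
      also have "\<dots> \<le> ennreal m" using cm by (rule ennreal_leI)
      finally have "ennreal (t powr (p / q)) / ennreal m \<le> ennreal (t powr (p / q)) / profile t"
        by (rule divide_left_mono_ennreal)
      then have "enn_powr (ennreal (t powr (p / q) / m)) \<beta> \<le> enn_powr (ennreal (t powr (p / q)) / profile t) \<beta>"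
        using m \<beta> by (intro enn_powr_mono) (simp_all add: divide_ennreal)
      from divide_right_mono_ennreal[OF this, of "ennreal t"]
      have *: "ennreal ((t powr (p / q) / m) powr \<beta> / t) \<le> integrand t"
        unfolding integrand_def \<beta>_def[symmetric] using t0 m
        by (simp add: enn_powr_ennreal divide_ennreal)
      have "(t powr (p / q) / m) powr \<beta> / t = t powr (p / q * \<beta> - 1) * m powr - \<beta>"
        using t0 m by (simp add: powr_divide powr_powr powr_diff powr_minus_divide)
      also have "p / q * \<beta> - 1 = \<beta>"
        using one_le_q q_less_p by (simp add: \<beta>_def field_simps)
      also have "m powr - \<beta> = d powr - \<beta> * x powr q"
      proof -
        have "(q - p) * - \<beta> = q" using q_less_p by (simp add: \<beta>_def divide_simps) (simp add: algebra_simps)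
        then show ?thesis using d x by (simp only: m_def powr_mult powr_powr)
      qed
      finally have "(t powr (p / q) / m) powr \<beta> / t = (t / d) powr \<beta> * x powr q"
        using t0 d by (simp add: powr_divide powr_minus_divide)
      moreover have "(1 / 2) powr \<beta> \<le> (t / d) powr \<beta>"
        using t0 d \<beta> by (intro powr_mono2) (auto simp: field_simps)
      then have "2 powr - \<beta> * x powr q \<le> (t / d) powr \<beta> * x powr q"
        by (intro mult_right_mono) (simp_all add: powr_divide powr_minus_divide)
      ultimately show ?thesis using * by (metis ennreal_leI order_trans)
    qed
    have "ennreal (2 powr - \<beta> * x powr q) * ennreal (d / 2)
        = (\<integral>\<^sup>+ t \<in> {a + d / 2<..<b}. ennreal (2 powr - \<beta> * x powr q) \<partial>lborel)"
      using d by (simp add: nn_integral_cmult_indicator d_def field_simps)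
    also have "\<dots> \<le> (\<integral>\<^sup>+ t \<in> {a<..<b}. integrand t \<partial>lborel)"
      using low d by (intro nn_integral_mono) (auto split: split_indicator)
    finally have "ennreal (2 powr (p / (p - q))) * (ennreal (2 powr - \<beta> * x powr q) * ennreal (d / 2))
        \<le> ennreal (2 powr (p / (p - q))) * (\<integral>\<^sup>+ t \<in> {a<..<b}. integrand t \<partial>lborel)"
      by (intro mult_left_mono) auto
    also have "ennreal (2 powr (p / (p - q))) * (ennreal (2 powr - \<beta> * x powr q) * ennreal (d / 2))
        = ennreal (x powr q * (b - a))"
    proof -
      have "p / (p - q) = 1 + \<beta>" using q_less_p by (simp add: \<beta>_def field_simps)
      then show ?thesis
        using d by (simp add: d_def powr_add powr_minus_divide flip: ennreal_mult)
    qed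
    finally show ?thesis by (rule add_increasing[rotated]) simp
  qed
qed

lemma nn_integral_disjoint_le:
  fixes f :: "'b \<Rightarrow> ennreal" and D :: "int \<Rightarrow> 'b set"
  assumes f: "f \<in> borel_measurable A" and D: "\<And>k. D k \<in> sets A" and disj: "disjoint_family D"
    and sub: "\<And>k. D k \<subseteq> T"
  shows "(\<integral>\<^sup>+ k. (\<integral>\<^sup>+ x \<in> D k. f x \<partial>A) \<partial>count_space UNIV) \<le> (\<integral>\<^sup>+ x \<in> T. f x \<partial>A)"
proof -
  have "(\<integral>\<^sup>+ k. (\<integral>\<^sup>+ x \<in> D k. f x \<partial>A) \<partial>count_space UNIV)
      = (\<integral>\<^sup>+ k. emeasure (density A f) (D k) \<partial>count_space UNIV)"
    using f D by (simp add: emeasure_density)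
  also have "\<dots> = emeasure (density A f) (\<Union>k. D k)"
    using D disj by (intro emeasure_UN_countable[symmetric]) auto
  also have "\<dots> = (\<integral>\<^sup>+ x \<in> (\<Union>k. D k). f x \<partial>A)"
    using f D by (intro emeasure_density) auto
  also have "\<dots> \<le> (\<integral>\<^sup>+ x \<in> T. f x \<partial>A)"
    using sub by (intro nn_integral_mono) (auto split: split_indicator)
  finally show ?thesis .
qed

text \<open>
  The truncation argument, with levels \<open>\<tau>\<^sub>k = K 2\<^sup>k\<close>: the normalisation by \<open>K\<close>, an upper bound for
  the norm of the gradient, takes the place of a rescaling of \<open>u\<close>. The superlevel set \<open>E k\<close> has
  capacity at most \<open>c k\<close>, the energy of \<open>g\<close> in the slice \<open>S k\<close> below it divided by \<open>\<tau>\<^sub>k\<^sub>-\<^sub>1\<^sup>p\<close>. The slices \<open>S k\<close> are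
  disjoint, and so are the intervals \<open>I k\<close> from \<open>\<nu> (E (k + 1))\<close> to \<open>\<nu> (E k)\<close>, so both terms of
  the dichotomy sum up over \<open>k\<close>.
\<close>

lemma dyadic_level_estimate:
  assumes fin: "profile_integral < \<infinity>" and K: "0 < K"
    and cont: "continuous_on \<Omega> u" and nonneg: "\<And>x. 0 \<le> u x" and zero: "\<And>x. x \<notin> \<Omega> \<Longrightarrow> u x = 0"
    and wug: "weak_upper_gradient \<mu> p (\<lambda>x. ereal (u x)) g" and g: "g \<in> borel_measurable borel"
    and gK: "(\<integral>\<^sup>+ x. enn_powr (g x) p \<partial>M) \<le> ennreal (K powr p)"
  shows "(\<integral>\<^sup>+ x \<in> \<Omega>. ennreal (u x powr q) \<partial>N.M)
    \<le> ennreal ((2 * K) powr q) * (ennreal (2 powr p) + ennreal (2 powr (p / (p - q))) * profile_integral)"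
proof -
  define \<tau> where "\<tau> k = K * 2 powr real_of_int k" for k :: int
  define E where "E k = {x. \<tau> k \<le> u x}" for k
  define D where "D k = {x. \<tau> k \<le> u x \<and> u x < \<tau> (k + 1)}" for k
  define S where "S k = {x. \<tau> (k - 1) < u x \<and> u x < \<tau> k}" for k
  define c where "c k = ennreal (\<tau> (k - 1) powr - p) * (\<integral>\<^sup>+ x \<in> S k. enn_powr (g x) p \<partial>M)" for k
  have p: "0 < p" and q: "0 < q" using one_le_q q_less_p by auto
  have \<tau>_pos: "0 < \<tau> k" for k using K by (simp add: \<tau>_def)
  have \<tau>_Suc: "\<tau> (k + 1) = 2 * \<tau> k" for k by (simp add: \<tau>_def powr_add)
  have \<tau>_mono: "\<tau> j \<le> \<tau> k" if "j \<le> k" for j k using that K by (simp add: \<tau>_def)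
  have u [measurable]: "u \<in> borel_measurable borel"
    by (rule borel_measurable_of_continuous_on_domain[OF cont zero])
  have "E k \<in> sets borel" "D k \<in> sets borel" "S k \<in> sets borel" for k
    unfolding E_def D_def S_def by measurable
  note sets [intro] = this
  have E_sub: "E k \<subseteq> \<Omega>" for k 
  proof
    fix x assume "x \<in> E k"
    then have "0 < u x" using \<tau>_pos[of k] by (simp add: E_def)
    then show "x \<in> \<Omega>" using zero[of x] by auto
  qed

  have cap: "variational_capacity \<mu> p (E k) \<Omega> \<le> c k" for k
  proof -
    define \<sigma> where "\<sigma> = \<tau> (k - 1)"
    have \<sigma>: "0 < \<sigma>" "\<tau> k = 2 * \<sigma>" using \<tau>_pos[of "k - 1"] \<tau>_Suc[of "k - 1"] by (auto simp: \<sigma>_def)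
    define v where "v x = min (\<tau> k) (max \<sigma> (u x))" for x
    define h where "h x = g x * indicator (S k) x" for x
    have h: "h \<in> borel_measurable borel" unfolding h_def using g sets(3)[of k] by simp
    have "weak_upper_gradient \<mu> p (\<lambda>x. ereal (v x)) h"
      unfolding v_def h_def S_def \<sigma>_def
      using gK by (intro weak_upper_gradient_truncate[OF wug g _ u]) (simp add: le_less_trans)
    then have wv: "weak_upper_gradient \<mu> p (\<lambda>x. ereal ((v x - \<sigma>) / \<sigma>)) (\<lambda>x. ennreal (1 / \<sigma>) * h x)"
      using \<sigma> h by (intro weak_upper_gradient_lipschitz_comp) (auto simp: field_simps simp flip: diff_divide_distrib abs_mult)
    have "variational_capacity \<mu> p (E k) \<Omega> \<le> (\<integral>\<^sup>+ x \<in> \<Omega>. enn_powr (ennreal (1 / \<sigma>) * h x) p \<partial>M)"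
    proof (rule variational_capacity_le[OF _ _ _ wv])
      show "continuous_on \<Omega> (\<lambda>x. (v x - \<sigma>) / \<sigma>)"
        unfolding v_def using \<sigma> by (intro continuous_intros cont) auto
    qed (use \<sigma> zero in \<open>auto simp: v_def E_def\<close>)
    also have "\<dots> \<le> (\<integral>\<^sup>+ x. ennreal (\<sigma> powr - p) * (enn_powr (g x) p * indicator (S k) x) \<partial>M)"
    proof (rule nn_integral_mono)
      fix x
      have "enn_powr (ennreal (1 / \<sigma>) * h x) p * indicator \<Omega> x \<le> enn_powr (ennreal (1 / \<sigma>) * h x) p"
        by (auto split: split_indicator)
      also have "\<dots> = ennreal (\<sigma> powr - p) * (enn_powr (g x) p * indicator (S k) x)"
        using p \<sigma> by (simp add: enn_powr_cmult h_def enn_powr_times_indicator powr_divide powr_minus_divide)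
      finally show "enn_powr (ennreal (1 / \<sigma>) * h x) p * indicator \<Omega> x
          \<le> ennreal (\<sigma> powr - p) * (enn_powr (g x) p * indicator (S k) x)" .
    qed
    also have "\<dots> = c k"
      unfolding c_def \<sigma>_def using g sets(3)[of k]
      by (intro nn_integral_cmult borel_measurableD borel_measurable_times_ennreal measurable_enn_powr) auto
    finally show ?thesis .
  qed
  have profile_le: "profile t \<le> c k" if "ennreal t \<le> \<nu> (E k)" for t k
    using profile_le_capacity[OF E_sub that] cap[of k] by simp

  have c_sum: "(\<integral>\<^sup>+ k. ennreal ((2 powr real_of_int k) powr p) * c k \<partial>count_space UNIV) \<le> ennreal (2 powr p)"
  proof -
    have eq: "ennreal ((2 powr real_of_int k) powr p) * c k
        = ennreal (2 powr p * K powr - p) * (\<integral>\<^sup>+ x \<in> S k. enn_powr (g x) p \<partial>M)" for k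
    proof -
      have "2 powr real_of_int k = 2 * \<tau> (k - 1) / K" using K \<tau>_Suc[of "k - 1"] by (simp add: \<tau>_def)
      then have "(2 powr real_of_int k) powr p * \<tau> (k - 1) powr - p = 2 powr p * K powr - p"
        using K \<tau>_pos[of "k - 1"] by (simp add: powr_mult powr_divide powr_minus_divide)
      then show ?thesis
        by (simp add: c_def mult.assoc[symmetric] flip: ennreal_mult)
    qed
    have "disjoint_family S"
      unfolding disjoint_family_on_def
    proof (intro ballI impI)
      have *: "S j \<inter> S k = {}" if "j < k" for j k
        using \<tau>_mono[of j "k - 1"] that by (auto simp: S_def)
      show "S j \<inter> S k = {}" if "j \<noteq> k" for j k
        using *[of j k] *[of k j] that by (cases "j < k") auto
    qed
    then have "(\<integral>\<^sup>+ k. (\<integral>\<^sup>+ x \<in> S k. enn_powr (g x) p \<partial>M) \<partial>count_space UNIV)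
        \<le> (\<integral>\<^sup>+ x \<in> UNIV. enn_powr (g x) p \<partial>M)"
      using g sets(3) by (intro nn_integral_disjoint_le borel_measurableD measurable_enn_powr) auto
    also have "\<dots> \<le> ennreal (K powr p)" using gK by simp
    finally have "ennreal (2 powr p * K powr - p) * (\<integral>\<^sup>+ k. (\<integral>\<^sup>+ x \<in> S k. enn_powr (g x) p \<partial>M) \<partial>count_space UNIV)
        \<le> ennreal (2 powr p * K powr - p) * ennreal (K powr p)"
      by (rule mult_left_mono) simp
    also have "\<dots> = ennreal (2 powr p)"
      using K by (simp add: powr_minus_divide flip: ennreal_mult)
    finally show ?thesis by (simp add: eq nn_integral_cmult)
  qed
  have c_fin: "c k < \<infinity>" for k
  proof -
    have "(\<integral>\<^sup>+ x \<in> S k. enn_powr (g x) p \<partial>M) \<le> (\<integral>\<^sup>+ x. enn_powr (g x) p \<partial>M)"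
      by (intro nn_integral_mono) (auto split: split_indicator)
    also have "\<dots> < \<infinity>" using gK by (simp add: le_less_trans)
    finally show ?thesis by (simp add: c_def ennreal_mult_less_top)
  qed

  define C where "C = ennreal (2 powr (p / (p - q)))"
  \<comment> \<open>If \<open>E k\<close> had infinite measure, the profile would be bounded by \<open>c k\<close> on arbitrarily long
    intervals, and the integral would diverge.\<close>
  have nu_fin: "\<nu> (E k) < \<infinity>" for k
  proof (rule ccontr)
    assume "\<not> \<nu> (E k) < \<infinity>"
    then have top: "\<nu> (E k) = \<infinity>" by (simp add: less_top[symmetric])
    then have top': "\<nu> \<Omega> = \<infinity>" using N.outer_mono[OF E_sub, of k] by (simp add: top_unique)
    define x where "x = 2 powr real_of_int k"
    define R where "R = ennreal (x powr p) * c k + C * profile_integral"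
    have "R < \<infinity>" using c_fin[of k] fin by (simp add: R_def C_def ennreal_mult_less_top)
    then obtain r where r: "R = ennreal r" "0 \<le> r" by (cases R) auto
    obtain n where n: "r < real n * x powr q"
      using reals_Archimedean3[of "x powr q"] by (auto simp: x_def)
    have "n > 0" using n r by (cases n) auto
    have "ennreal (x powr q * (real n - 0))
        \<le> ennreal (x powr p) * c k + C * (\<integral>\<^sup>+ t \<in> {0<..<real n}. integrand t \<partial>lborel)"
      unfolding C_def using \<open>n > 0\<close> top by (intro level_dichotomy profile_le) (auto simp: x_def)
    also have "\<dots> \<le> R"
      unfolding R_def profile_integral_def top'
      by (intro add_left_mono mult_left_mono nn_integral_mono) (auto split: split_indicator)
    finally show False using n r by (simp add: mult.commute)
  qed

  define I where "I k = {enn2real (\<nu> (E (k + 1)))<..<enn2real (\<nu> (E k))}" for k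
  have nu_eq: "\<nu> (E k) = ennreal (enn2real (\<nu> (E k)))" for k using nu_fin[of k] by simp
  have E_anti: "\<nu> (E k) \<le> \<nu> (E j)" if "j \<le> k" for j k
    using \<tau>_mono[OF that] by (intro N.outer_mono) (auto simp: E_def)
  have level: "ennreal ((2 powr real_of_int k) powr q) * \<nu> (D k)
      \<le> ennreal ((2 powr real_of_int k) powr p) * c k + C * (\<integral>\<^sup>+ t \<in> I k. integrand t \<partial>lborel)" for k
  proof -
    define a b where "a = enn2real (\<nu> (E (k + 1)))" and "b = enn2real (\<nu> (E k))"
    have ab: "\<nu> (E (k + 1)) = ennreal a" "\<nu> (E k) = ennreal b" "0 \<le> a" "0 \<le> b"
      using nu_eq by (auto simp: a_def b_def)
    have "a \<le> b" using E_anti[of k "k + 1"] ab by simp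
    have "E k = D k \<union> E (k + 1)" using \<tau>_mono[of k "k + 1"] by (auto simp: E_def D_def)
    moreover have "D k \<inter> E (k + 1) = {}" by (auto simp: E_def D_def)
    ultimately have "emeasure N.M (E k) = emeasure N.M (D k) + emeasure N.M (E (k + 1))"
      using sets by (simp add: plus_emeasure N.sets_borelD)
    then have "ennreal b = \<nu> (D k) + ennreal a"
      using sets ab by (simp add: N.emeasure_eq N.sets_borelD)
    then have D_eq: "\<nu> (D k) = ennreal (b - a)"
      using ab by (metis ennreal_add_diff_cancel_right ennreal_minus ennreal_neq_top)
    show ?thesis
    proof (cases "a = b")
      case True then show ?thesis by (simp add: D_eq)
    next
      case False
      have "ennreal ((2 powr real_of_int k) powr q * (b - a))
          \<le> ennreal ((2 powr real_of_int k) powr p) * c k + C * (\<integral>\<^sup>+ t \<in> {a<..<b}. integrand t \<partial>lborel)"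
        unfolding C_def using \<open>a \<le> b\<close> False ab
        by (intro level_dichotomy profile_le) (auto intro: ennreal_leI)
      then show ?thesis using \<open>a \<le> b\<close> by (simp add: D_eq I_def a_def b_def ennreal_mult)
    qed
  qed
  have I_sum: "(\<integral>\<^sup>+ k. (\<integral>\<^sup>+ t \<in> I k. integrand t \<partial>lborel) \<partial>count_space UNIV) \<le> profile_integral"
    unfolding profile_integral_def
  proof (rule nn_integral_disjoint_le)
    show "disjoint_family I"
      unfolding disjoint_family_on_def
    proof (intro ballI impI)
      have *: "I j \<inter> I k = {}" if "j < k" for j k
        using E_anti[of "j + 1" k] that nu_eq[of k] nu_eq[of "j + 1"]
        by (force simp: I_def dest: enn2real_mono[OF _ nu_fin[unfolded infinity_ennreal_def]])
      show "I j \<inter> I k = {}" if "j \<noteq> k" for j k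
        using *[of j k] *[of k j] that by (cases "j < k") auto
    qed
    show "I k \<subseteq> {t. 0 < t \<and> ennreal t < \<nu> \<Omega>}" for k
    proof
      fix t assume t: "t \<in> I k"
      then have "0 < t" by (auto simp: I_def intro: le_less_trans[OF enn2real_nonneg])
      moreover have "ennreal t < \<nu> (E k)" using t \<open>0 < t\<close> by (subst nu_eq) (auto simp: I_def ennreal_lessI)
      ultimately show "t \<in> {t. 0 < t \<and> ennreal t < \<nu> \<Omega>}"
        using N.outer_mono[OF E_sub, of k] by auto
    qed
  qed (auto simp: I_def)

  have "(\<integral>\<^sup>+ x \<in> \<Omega>. ennreal (u x powr q) \<partial>N.M)
      \<le> (\<integral>\<^sup>+ x. (\<integral>\<^sup>+ k. ennreal (\<tau> (k + 1) powr q) * indicator (D k) x \<partial>count_space UNIV) \<partial>N.M)"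
  proof (rule nn_integral_mono)
    fix x
    show "ennreal (u x powr q) * indicator \<Omega> x
        \<le> (\<integral>\<^sup>+ k. ennreal (\<tau> (k + 1) powr q) * indicator (D k) x \<partial>count_space UNIV)"
    proof (cases "u x = 0")
      case False
      then have ux: "0 < u x" using nonneg[of x] by simp
      define k where "k = \<lfloor>log 2 (u x / K)\<rfloor>"
      have "2 powr real_of_int k \<le> u x / K" "u x / K < 2 powr (real_of_int k + 1)"
        using ux K unfolding k_def by (simp_all add: floor_log_eq_powr_iff[symmetric] le_log_iff[symmetric] log_less_iff[symmetric])
      then have Dk: "x \<in> D k" using K by (simp add: D_def \<tau>_def field_simps)
      then have "ennreal (u x powr q) * indicator \<Omega> x \<le> ennreal (\<tau> (k + 1) powr q) * indicator (D k) x"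
        using q ux by (auto simp: D_def split: split_indicator intro!: ennreal_leI powr_mono2)
      also have "\<dots> \<le> (\<integral>\<^sup>+ k. ennreal (\<tau> (k + 1) powr q) * indicator (D k) x \<partial>count_space UNIV)"
        by (rule nn_integral_ge_point) simp
      finally show ?thesis .
    qed simp
  qed
  also have "\<dots> = (\<integral>\<^sup>+ k. (\<integral>\<^sup>+ x. ennreal (\<tau> (k + 1) powr q) * indicator (D k) x \<partial>N.M) \<partial>count_space UNIV)"
    using sets by (intro nn_integral_count_space_nn_integral) (auto simp: N.sets_borelD)
  also have "\<dots> = (\<integral>\<^sup>+ k. ennreal ((2 * K) powr q) * (ennreal ((2 powr real_of_int k) powr q) * \<nu> (D k)) \<partial>count_space UNIV)"
  proof (rule nn_integral_cong)
    fix k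
    have "(\<integral>\<^sup>+ x. ennreal (\<tau> (k + 1) powr q) * indicator (D k) x \<partial>N.M) = ennreal (\<tau> (k + 1) powr q) * \<nu> (D k)"
      using sets(2)[of k] by (simp add: nn_integral_cmult_indicator N.sets_borelD N.emeasure_eq)
    moreover have "\<tau> (k + 1) powr q = (2 * K) powr q * (2 powr real_of_int k) powr q"
      using K by (simp add: \<tau>_def powr_add powr_mult)
    ultimately show "(\<integral>\<^sup>+ x. ennreal (\<tau> (k + 1) powr q) * indicator (D k) x \<partial>N.M)
        = ennreal ((2 * K) powr q) * (ennreal ((2 powr real_of_int k) powr q) * \<nu> (D k))"
      by (simp add: ennreal_mult mult.assoc)
  qed
  also have "\<dots> = ennreal ((2 * K) powr q) * (\<integral>\<^sup>+ k. ennreal ((2 powr real_of_int k) powr q) * \<nu> (D k) \<partial>count_space UNIV)"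
    by (simp add: nn_integral_cmult)
  also have "\<dots> \<le> ennreal ((2 * K) powr q) * (\<integral>\<^sup>+ k. ennreal ((2 powr real_of_int k) powr p) * c k
      + C * (\<integral>\<^sup>+ t \<in> I k. integrand t \<partial>lborel) \<partial>count_space UNIV)"
    by (intro mult_left_mono nn_integral_mono level) simp
  also have "\<dots> = ennreal ((2 * K) powr q) * ((\<integral>\<^sup>+ k. ennreal ((2 powr real_of_int k) powr p) * c k \<partial>count_space UNIV)
      + C * (\<integral>\<^sup>+ k. (\<integral>\<^sup>+ t \<in> I k. integrand t \<partial>lborel) \<partial>count_space UNIV))"
    by (simp add: nn_integral_add nn_integral_cmult)
  also have "\<dots> \<le> ennreal ((2 * K) powr q) * (ennreal (2 powr p) + C * profile_integral)"
    by (intro mult_left_mono add_mono c_sum I_sum) auto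
  finally show ?thesis by (simp add: C_def)
qed

text \<open>
  The level estimate holds for every \<open>K > 0\<close> that bounds the norm of the gradient. Letting \<open>K\<close>
  decrease to the norm covers the case of a vanishing gradient as well.
\<close>

lemma sobolev_of_profile_integral:
  assumes fin: "profile_integral < \<infinity>"
  shows "\<exists>c>0. \<forall>u g. continuous_on \<Omega> u \<longrightarrow> (\<forall>x. x \<notin> \<Omega> \<longrightarrow> u x = 0) \<longrightarrow>
    weak_upper_gradient \<mu> p (\<lambda>x. ereal (u x)) g \<longrightarrow>
    enn_powr (\<integral>\<^sup>+ x \<in> \<Omega>. ennreal (\<bar>u x\<bar> powr q) \<partial>N.M) (1 / q)
      \<le> ennreal c * enn_powr (\<integral>\<^sup>+ x \<in> \<Omega>. enn_powr (g x) p \<partial>M) (1 / p)"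
proof -
  have p: "0 < p" and q: "0 < q" using one_le_q q_less_p by auto
  obtain j where j: "profile_integral = ennreal j" "0 \<le> j" using fin by (cases profile_integral) auto
  define C where "C = 2 powr p + 2 powr (p / (p - q)) * j"
  have C: "0 < C" using j by (simp add: C_def add_pos_nonneg)
  define c where "c = 2 * C powr (1 / q)"
  have c: "0 < c" using C by (simp add: c_def)
  show ?thesis
  proof (intro exI[of _ c] conjI allI impI c)
    fix u :: "'a \<Rightarrow> real" and g
    assume cont: "continuous_on \<Omega> u" and zero: "\<forall>x. x \<notin> \<Omega> \<longrightarrow> u x = 0"
      and wug: "weak_upper_gradient \<mu> p (\<lambda>x. ereal (u x)) g"
    define J where "J = (\<integral>\<^sup>+ x \<in> \<Omega>. enn_powr (g x) p \<partial>M)"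
    obtain g' where g': "g' \<in> borel_measurable borel" "weak_upper_gradient \<mu> p (\<lambda>x. ereal (u x)) g'"
      "\<And>A. (\<integral>\<^sup>+ x \<in> A. enn_powr (g' x) p \<partial>M) = (\<integral>\<^sup>+ x \<in> A. enn_powr (g x) p \<partial>M)"
      by (rule borel_weak_upper_gradient[OF wug]) blast
    have "weak_upper_gradient \<mu> p (\<lambda>x. ereal \<bar>u x\<bar>) (\<lambda>x. ennreal 1 * g' x)"
      by (rule weak_upper_gradient_lipschitz_comp[OF g'(2,1)]) auto
    then have wabs: "weak_upper_gradient \<mu> p (\<lambda>x. ereal \<bar>u x\<bar>) (\<lambda>x. g' x * indicator \<Omega> x)"
      using zero by (intro weak_upper_gradient_restrict g'(1) open_domain) auto
    have J_eq: "(\<integral>\<^sup>+ x. enn_powr (g' x * indicator \<Omega> x) p \<partial>M) = J"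
      unfolding J_def g'(3)[symmetric] by (simp add: enn_powr_times_indicator)
    have bound: "enn_powr (\<integral>\<^sup>+ x \<in> \<Omega>. ennreal (\<bar>u x\<bar> powr q) \<partial>N.M) (1 / q) \<le> ennreal (c * K)"
      if K: "0 < K" "J \<le> ennreal (K powr p)" for K
    proof -
      have "(\<integral>\<^sup>+ x \<in> \<Omega>. ennreal (\<bar>u x\<bar> powr q) \<partial>N.M)
          \<le> ennreal ((2 * K) powr q) * (ennreal (2 powr p) + ennreal (2 powr (p / (p - q))) * profile_integral)"
        using zero g'(1) open_domain K cont
        by (intro dyadic_level_estimate[OF fin _ _ _ _ wabs])
           (auto simp: J_eq intro: continuous_intros)
      also have "\<dots> = ennreal ((2 * K) powr q * C)"
        using j by (simp add: C_def flip: ennreal_mult ennreal_plus)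
      finally have "enn_powr (\<integral>\<^sup>+ x \<in> \<Omega>. ennreal (\<bar>u x\<bar> powr q) \<partial>N.M) (1 / q)
          \<le> enn_powr (ennreal ((2 * K) powr q * C)) (1 / q)"
        using q by (intro enn_powr_mono) auto
      also have "\<dots> = ennreal (c * K)"
        using q C K by (simp add: enn_powr_ennreal powr_mult powr_powr c_def mult_ac)
      finally show ?thesis .
    qed
    have "enn_powr (\<integral>\<^sup>+ x \<in> \<Omega>. ennreal (\<bar>u x\<bar> powr q) \<partial>N.M) (1 / q) \<le> ennreal c * enn_powr J (1 / p)"
    proof (cases J)
      case top
      then show ?thesis using c by (simp add: ennreal_mult_top)
    next
      case (real i)
      show ?thesis
      proof (rule ennreal_le_epsilon)
        fix e :: real assume e: "0 < e"
        define K where "K = i powr (1 / p) + e / c"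
        have K: "0 < K" using e c by (simp add: K_def add_nonneg_pos)
        have "i = (i powr (1 / p)) powr p" using real p by (simp add: powr_powr)
        also have "\<dots> \<le> K powr p" using p e c by (intro powr_mono2) (auto simp: K_def)
        finally have "J \<le> ennreal (K powr p)" using real by (simp add: ennreal_leI)
        from bound[OF K this]
        show "enn_powr (\<integral>\<^sup>+ x \<in> \<Omega>. ennreal (\<bar>u x\<bar> powr q) \<partial>N.M) (1 / q)
            \<le> ennreal c * enn_powr J (1 / p) + ennreal e"
          using real c e by (simp add: K_def enn_powr_ennreal distrib_left flip: ennreal_mult ennreal_plus)
      qed
    qed
    then show "enn_powr (\<integral>\<^sup>+ x \<in> \<Omega>. ennreal (\<bar>u x\<bar> powr q) \<partial>N.M) (1 / q)
      \<le> ennreal c * enn_powr (\<integral>\<^sup>+ x \<in> \<Omega>. enn_powr (g x) p \<partial>M) (1 / p)"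
      by (simp add: J_def)
  qed
qed

end

section \<open>The Sobolev inequality implies a finite profile integral\<close>

text \<open>There is only one \<open>2^k\<close> for each integer \<open>k < m\<close>, and these add up to \<open>2^m\<close>.\<close>

lemma sum_powers_of_two_less:
  assumes "finite J" "\<And>j. j \<in> J \<Longrightarrow> j < m"
  shows "(\<Sum>j\<in>J. 2 powr real_of_int j) \<le> 2 powr real_of_int m"
  using assms
proof (induction J arbitrary: m rule: finite_linorder_max_induct)
  case (insert b A)
  have "(\<Sum>j\<in>insert b A. 2 powr real_of_int j) \<le> 2 powr real_of_int b + 2 powr real_of_int b"
    using insert by (subst sum.insert) auto
  also have "\<dots> = 2 powr (real_of_int b + 1)" by (simp add: powr_add)
  also have "\<dots> \<le> 2 powr real_of_int m" using insert.prems[of b] by (intro powr_mono) auto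
  finally show ?case .
qed simp

text \<open>
  A discrete layer-cake estimate. As the heights \<open>a j\<close> come in no particular order, the superlevel
  sets need not be nested along \<open>j\<close>. The largest index is removed by cutting \<open>f\<close> at its height \<open>A\<close>:
  the lower part \<open>min f A\<close>, counted twice, pays for \<open>A\<close> at this index and, as the smaller powers of two add up to at most the
  largest one, at all the others; the upper part \<open>f - A\<close> is left to the induction.
\<close>

lemma sum_level_sets_le_nn_integral:
  fixes f :: "'b \<Rightarrow> ennreal" and a :: "int \<Rightarrow> ennreal"
  assumes "finite J" "f \<in> borel_measurable L" "\<And>j. j \<in> J \<Longrightarrow> a j < \<infinity>"
    and "\<And>j. j \<in> J \<Longrightarrow> ennreal (2 powr real_of_int j) \<le> emeasure L {x \<in> space L. a j \<le> f x}"
  shows "(\<Sum>j\<in>J. ennreal (2 powr real_of_int j) * a j) \<le> 2 * (\<integral>\<^sup>+ x. f x \<partial>L)"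
  using assms
proof (induction J arbitrary: f a rule: finite_linorder_max_induct)
  case (insert m J)
  note f [measurable] = insert.prems(1)
  define A where "A = a m"
  define P where "P j = ennreal (2 powr real_of_int j)" for j :: int
  have A: "A < \<infinity>" using insert.prems(2) by (simp add: A_def)
  have split: "f x = min (f x) A + (f x - A)" for x
    using A by (cases "f x \<le> A")
      (auto simp: min_def diff_eq_0_ennreal less_top add_diff_inverse_ennreal not_le)
  have IH: "(\<Sum>j\<in>J. P j * (a j - A)) \<le> 2 * (\<integral>\<^sup>+ x. f x - A \<partial>L)"
    unfolding P_def
  proof (rule insert.IH)
    show "(\<lambda>x. f x - A) \<in> borel_measurable L" by measurable
    show "a j - A < \<infinity>" if "j \<in> J" for j
      using insert.prems(2)[of j] that by (simp add: less_top[symmetric])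
    show "ennreal (2 powr real_of_int j) \<le> emeasure L {x \<in> space L. a j - A \<le> f x - A}" if "j \<in> J" for j
    proof -
      have "ennreal (2 powr real_of_int j) \<le> emeasure L {x \<in> space L. a j \<le> f x}"
        using insert.prems(3) that by simp
      also have "\<dots> \<le> emeasure L {x \<in> space L. a j - A \<le> f x - A}"
        by (intro emeasure_mono) (auto intro: ennreal_minus_mono)
      finally show ?thesis .
    qed
  qed
  have low: "P m * A \<le> (\<integral>\<^sup>+ x. min (f x) A \<partial>L)"
  proof -
    have "P m * A \<le> A * emeasure L {x \<in> space L. A \<le> f x}"
      unfolding P_def A_def mult.commute[of _ "a m"]
      by (rule mult_left_mono) (simp_all add: insert.prems(3))
    also have "\<dots> = (\<integral>\<^sup>+ x. A * indicator {x \<in> space L. A \<le> f x} x \<partial>L)"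
      by (intro nn_integral_cmult_indicator[symmetric]) measurable
    also have "\<dots> \<le> (\<integral>\<^sup>+ x. min (f x) A \<partial>L)"
      by (intro nn_integral_mono) (auto split: split_indicator)
    finally show ?thesis .
  qed
  have sumP: "(\<Sum>j\<in>J. P j) \<le> P m"
    using sum_powers_of_two_less[of J m] insert.hyps by (simp add: P_def sum_ennreal ennreal_leI)
  have "m \<notin> J" using insert.hyps by blast
  then have "(\<Sum>j\<in>insert m J. P j * a j) = P m * A + (\<Sum>j\<in>J. P j * a j)"
    using insert.hyps by (simp add: A_def)
  also have "(\<Sum>j\<in>J. P j * a j) \<le> (\<Sum>j\<in>J. P j * A + P j * (a j - A))"
  proof (rule sum_mono)
    fix j assume "j \<in> J"
    have "a j \<le> A + (a j - A)" using A by (cases "a j \<le> A") (auto simp: add_diff_inverse_ennreal less_top add_increasing2 not_le)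
    then have "P j * a j \<le> P j * (A + (a j - A))" by (rule mult_left_mono) simp
    then show "P j * a j \<le> P j * A + P j * (a j - A)" by (simp add: distrib_left)
  qed
  also have "\<dots> = (\<Sum>j\<in>J. P j) * A + (\<Sum>j\<in>J. P j * (a j - A))"
    by (simp add: sum.distrib sum_distrib_right)
  also have "\<dots> \<le> P m * A + 2 * (\<integral>\<^sup>+ x. f x - A \<partial>L)"
    by (intro add_mono mult_right_mono sumP IH) simp
  finally have "(\<Sum>j\<in>insert m J. P j * a j) \<le> 2 * (P m * A) + 2 * (\<integral>\<^sup>+ x. f x - A \<partial>L)"
    by (simp add: mult_2 add.assoc add_left_mono)
  also have "\<dots> \<le> 2 * (\<integral>\<^sup>+ x. min (f x) A \<partial>L) + 2 * (\<integral>\<^sup>+ x. f x - A \<partial>L)"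
    by (intro add_mono mult_left_mono low) auto
  also have "\<dots> = 2 * (\<integral>\<^sup>+ x. min (f x) A + (f x - A) \<partial>L)"
    by (subst nn_integral_add) (auto simp: distrib_left)
  also have "(\<lambda>x. min (f x) A + (f x - A)) = f" using split by auto
  finally show ?case by (simp add: P_def)
qed simp

context capacity_setting
begin

definition bounded_test_pair :: "('a \<Rightarrow> real) \<Rightarrow> ('a \<Rightarrow> ennreal) \<Rightarrow> real \<Rightarrow> bool" where
  "bounded_test_pair u g B \<longleftrightarrow>
     continuous_on \<Omega> u \<and> (\<forall>x. 0 \<le> u x \<and> u x \<le> B) \<and> (\<forall>x. x \<notin> \<Omega> \<longrightarrow> u x = 0) \<and>
     weak_upper_gradient \<mu> p (\<lambda>x. ereal (u x)) g \<and> g \<in> borel_measurable borel"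

lemma bounded_test_pairD:
  assumes "bounded_test_pair u g B"
  shows "continuous_on \<Omega> u" "0 \<le> u x" "u x \<le> B" "x \<notin> \<Omega> \<Longrightarrow> u x = 0"
    "weak_upper_gradient \<mu> p (\<lambda>x. ereal (u x)) g" "g \<in> borel_measurable borel"
  using assms by (auto simp: bounded_test_pair_def)

text \<open>
  Maxima of capacity test functions are used in place of sums, since the \<open>p\<close>-th power of a maximum of gradients is
  at most the sum of the \<open>p\<close>-th powers.
\<close>

lemma combined_test_function:
  assumes "finite J" "\<And>j. j \<in> J \<Longrightarrow> 0 < h j" "\<And>j. j \<in> J \<Longrightarrow> 0 < l j"
    and "\<And>j. j \<in> J \<Longrightarrow> variational_capacity \<mu> p (G j) \<Omega> < ennreal (l j)"
  shows "\<exists>u g B. bounded_test_pair u g B \<and> (\<forall>j\<in>J. \<forall>x\<in>G j. h j \<le> u x)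
    \<and> (\<integral>\<^sup>+ x \<in> \<Omega>. enn_powr (g x) p \<partial>M) \<le> ennreal (\<Sum>j\<in>J. h j powr p * l j)"
  using assms
proof (induction J rule: finite_induct)
  case empty
  have "weak_upper_gradient \<mu> p (\<lambda>x. ereal 0) (\<lambda>x. 0)"
    by (auto simp: weak_upper_gradient_real almost_every_path_def zero_modulus_def intro!: bexI[of _ "\<lambda>x. 0"])
  then show ?case
    by (intro exI[of _ "\<lambda>x. 0"] exI[of _ 0]) (auto simp: bounded_test_pair_def)
next
  case (insert i J)
  have p: "0 < p" using one_le_q q_less_p by simp
  have hi: "0 < h i" and li: "0 < l i" using insert.prems by auto
  obtain u g B where test: "bounded_test_pair u g B"
    and uG: "\<forall>j\<in>J. \<forall>x\<in>G j. h j \<le> u x"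
    and gint: "(\<integral>\<^sup>+ x \<in> \<Omega>. enn_powr (g x) p \<partial>M) \<le> ennreal (\<Sum>j\<in>J. h j powr p * l j)"
    using insert.IH[OF insert.prems(1)[OF insertI2] insert.prems(2)[OF insertI2] insert.prems(3)[OF insertI2]]
    by blast
  note u = bounded_test_pairD(1-4)[OF test]
  note wug = bounded_test_pairD(5)[OF test] and g = bounded_test_pairD(6)[OF test]
  obtain w k where w: "continuous_on \<Omega> w" "\<And>x. x \<in> G i \<Longrightarrow> w x = 1" "\<And>x. x \<notin> \<Omega> \<Longrightarrow> w x = 0"
    and wk: "weak_upper_gradient \<mu> p (\<lambda>x. ereal (w x)) k"
    and kint: "(\<integral>\<^sup>+ x \<in> \<Omega>. enn_powr (k x) p \<partial>M) < ennreal (l i)"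
    using insert.prems(3)[of i] unfolding variational_capacity_def INF_less_iff by auto
  obtain k' where k': "k' \<in> borel_measurable borel" "weak_upper_gradient \<mu> p (\<lambda>x. ereal (w x)) k'"
    "\<And>A. (\<integral>\<^sup>+ x \<in> A. enn_powr (k' x) p \<partial>M) = (\<integral>\<^sup>+ x \<in> A. enn_powr (k x) p \<partial>M)"
    by (rule borel_weak_upper_gradient[OF wk]) blast
  define v where "v x = h i * min 1 (max 0 (w x))" for x
  define g2 where "g2 x = ennreal (h i) * k' x" for x
  have g2: "g2 \<in> borel_measurable borel" unfolding g2_def using k'(1) by simp
  have wv: "weak_upper_gradient \<mu> p (\<lambda>x. ereal (v x)) g2"
    unfolding g2_def
  proof (rule weak_upper_gradient_lipschitz_comp[OF k'(2,1)])
    fix x y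
    have "\<bar>min 1 (max 0 (w x)) - min 1 (max 0 (w y))\<bar> \<le> \<bar>w x - w y\<bar>" by linarith
    then have "h i * \<bar>min 1 (max 0 (w x)) - min 1 (max 0 (w y))\<bar> \<le> h i * \<bar>w x - w y\<bar>"
      using hi by (intro mult_left_mono) auto
    moreover have "\<bar>v x - v y\<bar> = h i * \<bar>min 1 (max 0 (w x)) - min 1 (max 0 (w y))\<bar>"
      using hi by (simp add: v_def abs_mult flip: right_diff_distrib)
    ultimately show "\<bar>v x - v y\<bar> \<le> h i * \<bar>w x - w y\<bar>" by simp
  qed (use hi in simp)
  have "(\<integral>\<^sup>+ x \<in> \<Omega>. enn_powr (max (g x) (g2 x)) p \<partial>M)
      \<le> (\<integral>\<^sup>+ x. enn_powr (g x) p * indicator \<Omega> x + ennreal (h i powr p) * (enn_powr (k' x) p * indicator \<Omega> x) \<partial>M)"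
  proof (rule nn_integral_mono)
    fix x
    show "enn_powr (max (g x) (g2 x)) p * indicator \<Omega> x
        \<le> enn_powr (g x) p * indicator \<Omega> x + ennreal (h i powr p) * (enn_powr (k' x) p * indicator \<Omega> x)"
      using enn_powr_max_le[of "g x" "g2 x" p] hi p by (auto simp: g2_def enn_powr_cmult split: split_indicator)
  qed
  also have "\<dots> = (\<integral>\<^sup>+ x \<in> \<Omega>. enn_powr (g x) p \<partial>M) + ennreal (h i powr p) * (\<integral>\<^sup>+ x \<in> \<Omega>. enn_powr (k' x) p \<partial>M)"
  proof -
    have 1: "(\<lambda>x. enn_powr (g x) p * indicator \<Omega> x) \<in> borel_measurable M"
      "(\<lambda>x. enn_powr (k' x) p * indicator \<Omega> x) \<in> borel_measurable M"
      using g k'(1) open_domain by (auto intro!: borel_measurableD)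
    then show ?thesis by (simp add: nn_integral_add nn_integral_cmult)
  qed
  also have "\<dots> \<le> ennreal (\<Sum>j\<in>J. h j powr p * l j) + ennreal (h i powr p) * ennreal (l i)"
    using kint by (intro add_mono mult_left_mono gint) (auto simp: k'(3))
  also have "\<dots> = ennreal (\<Sum>j\<in>insert i J. h j powr p * l j)"
  proof -
    have "0 \<le> (\<Sum>j\<in>J. h j powr p * l j)" using insert.prems by (intro sum_nonneg) (auto simp: less_imp_le)
    then show ?thesis using insert.hyps li by (simp add: add.commute flip: ennreal_mult ennreal_plus)
  qed
  finally have int: "(\<integral>\<^sup>+ x \<in> \<Omega>. enn_powr (max (g x) (g2 x)) p \<partial>M) \<le> ennreal (\<Sum>j\<in>insert i J. h j powr p * l j)" .
  have v: "0 \<le> v x" "v x \<le> h i" "x \<notin> \<Omega> \<Longrightarrow> v x = 0" "x \<in> G i \<Longrightarrow> v x = h i" for x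
    using hi w by (auto simp: v_def mult_le_cancel_left1)
  show ?case
    unfolding bounded_test_pair_def
  proof (intro exI[of _ "\<lambda>x. max (u x) (v x)"] exI[of _ "\<lambda>x. max (g x) (g2 x)"] exI[of _ "max B (h i)"] conjI allI impI ballI)
    show "continuous_on \<Omega> (\<lambda>x. max (u x) (v x))"
      unfolding v_def by (intro continuous_intros u w)
    show "weak_upper_gradient \<mu> p (\<lambda>x. ereal (max (u x) (v x))) (\<lambda>x. max (g x) (g2 x))"
      by (rule weak_upper_gradient_max[OF wug g wv g2])
    show "(\<lambda>x. max (g x) (g2 x)) \<in> borel_measurable borel" using g g2 by simp
    show "(\<integral>\<^sup>+ x \<in> \<Omega>. enn_powr (max (g x) (g2 x)) p \<partial>M) \<le> ennreal (\<Sum>j\<in>insert i J. h j powr p * l j)"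
      by (rule int)
    fix x
    show "0 \<le> max (u x) (v x)" using u(2)[of x] by simp
    show "max (u x) (v x) \<le> max B (h i)" using u(3)[of x] v(2)[of x] by (intro max.mono)
    show "max (u x) (v x) = 0" if "x \<notin> \<Omega>" using u(4) v(3) that by simp
    show "h j \<le> max (u x) (v x)" if "j \<in> insert i J" "x \<in> G j" for j
      using that uG v(4)[of x] by (auto simp: le_max_iff_disj)
  qed
qed

text \<open>
  Capacity test functions carry no bound on their gradient outside \<open>\<Omega>\<close>; restricting it to \<open>\<Omega>\<close>
  makes the norm finite.
\<close>

lemma bounded_in_newtonian_zero:
  assumes test: "bounded_test_pair u g B"
    and fin: "(\<integral>\<^sup>+ x \<in> \<Omega>. enn_powr (g x) p \<partial>M) < \<infinity>" and \<mu>\<Omega>: "\<mu> \<Omega> < \<infinity>"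
  shows "(\<lambda>x. ereal (u x)) \<in> newtonian_zero \<mu> p \<Omega>"
proof -
  note cont = bounded_test_pairD(1)[OF test] and u = bounded_test_pairD(2,3)[OF test]
    and zero = bounded_test_pairD(4)[OF test] and wug = bounded_test_pairD(5)[OF test]
    and g = bounded_test_pairD(6)[OF test]
  have p: "0 < p" using one_le_q q_less_p by simp
  have \<Omega>: "\<Omega> \<in> sets M" using open_domain by (intro sets_borelD) auto
  have "(\<integral>\<^sup>+ x. enn_powr (e2ennreal \<bar>ereal (u x)\<bar>) p \<partial>M) \<le> (\<integral>\<^sup>+ x. ennreal (B powr p) * indicator \<Omega> x \<partial>M)"
  proof (rule nn_integral_mono)
    fix x
    show "enn_powr (e2ennreal \<bar>ereal (u x)\<bar>) p \<le> ennreal (B powr p) * indicator \<Omega> x"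
      using u[of x] zero[of x] p
      by (cases "x \<in> \<Omega>") (auto simp: e2ennreal_ereal enn_powr_ennreal intro!: ennreal_leI powr_mono2)
  qed
  also have "\<dots> = ennreal (B powr p) * \<mu> \<Omega>" using \<Omega> by (simp add: nn_integral_cmult_indicator emeasure_eq)
  also have "\<dots> < \<infinity>" using \<mu>\<Omega> by (simp add: ennreal_mult_less_top)
  finally have 1: "(\<integral>\<^sup>+ x. enn_powr (e2ennreal \<bar>ereal (u x)\<bar>) p \<partial>M) < \<infinity>" .
  have "weak_upper_gradient \<mu> p (\<lambda>x. ereal (u x)) (\<lambda>x. g x * indicator \<Omega> x)"
    by (rule weak_upper_gradient_restrict[OF wug g open_domain u(1) zero])
  then have "(INF g \<in> {g. weak_upper_gradient \<mu> p (\<lambda>x. ereal (u x)) g}. \<integral>\<^sup>+ x. enn_powr (g x) p \<partial>M)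
      \<le> (\<integral>\<^sup>+ x. enn_powr (g x * indicator \<Omega> x) p \<partial>M)"
    by (intro INF_lower) simp
  also have "\<dots> < \<infinity>" using fin by (simp add: enn_powr_times_indicator)
  finally have 2: "(INF g \<in> {g. weak_upper_gradient \<mu> p (\<lambda>x. ereal (u x)) g}. \<integral>\<^sup>+ x. enn_powr (g x) p \<partial>M) < \<infinity>" .
  have "newtonian_norm \<mu> p (\<lambda>x. ereal (u x)) < \<infinity>"
    using 1 2 by (simp add: newtonian_norm_def enn_powr_def ennreal_add_eq_top less_top[symmetric])
  moreover have "(\<lambda>x. ereal (u x)) \<in> borel_measurable M"
    using borel_measurable_of_continuous_on_domain[OF cont zero]
    by (intro borel_measurable_ereal borel_measurableD)
  ultimately have mem: "(\<lambda>x. ereal (u x)) \<in> newtonian \<mu> p" by (simp add: newtonian_def)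
  have wug0: "weak_upper_gradient \<mu> p (\<lambda>x. ereal 0) (\<lambda>x. 0)"
    by (auto simp: weak_upper_gradient_real almost_every_path_def zero_modulus_def intro!: bexI[of _ "\<lambda>x. 0"])
  have "(INF g \<in> {g. weak_upper_gradient \<mu> p (\<lambda>x. 0) g}. \<integral>\<^sup>+ x. enn_powr (g x) p \<partial>M) \<le> (\<integral>\<^sup>+ x. enn_powr 0 p \<partial>M)"
    using wug0 by (intro INF_lower) (simp add: zero_ereal_def)
  then have norm0: "newtonian_norm \<mu> p (\<lambda>x. 0) = 0"
    using e2ennreal_ereal[of 0] by (simp add: newtonian_norm_def zero_ereal_def)
  have "sobolev_capacity \<mu> p {} \<le> enn_powr (newtonian_norm \<mu> p (\<lambda>x. 0)) p"
    unfolding sobolev_capacity_def by (intro INF_lower) (simp add: newtonian_def norm0)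
  then have "sobolev_capacity \<mu> p {} = 0" by (simp add: norm0)
  then have "quasieverywhere \<mu> p (\<lambda>x. x \<notin> \<Omega> \<longrightarrow> ereal (u x) = 0)"
    using zero by (simp add: quasieverywhere_def)
  moreover have "(\<lambda>x. ereal (u x)) = (\<lambda>x. if x \<in> \<Omega> then ereal (u x) else 0)" using zero by auto
  ultimately show ?thesis
    unfolding newtonian_zero_def mem_Collect_eq using mem
    by (intro exI[of _ "\<lambda>x. ereal (u x)"] conjI)
qed

definition sobolev_inequality :: "real \<Rightarrow> bool" where
  "sobolev_inequality c \<longleftrightarrow> (\<forall>(u :: 'a \<Rightarrow> real) g.
     (\<lambda>x. ereal (u x)) \<in> newtonian_zero \<mu> p \<Omega> \<longrightarrow> continuous_on \<Omega> u \<longrightarrow>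
     weak_upper_gradient \<mu> p (\<lambda>x. ereal (u x)) g \<longrightarrow>
     enn_powr (\<integral>\<^sup>+ x \<in> \<Omega>. ennreal (\<bar>u x\<bar> powr q) \<partial>N.M) (1 / q)
       \<le> ennreal c * enn_powr (\<integral>\<^sup>+ x \<in> \<Omega>. enn_powr (g x) p \<partial>M) (1 / p))"

text \<open>
  The weights \<open>h j = (2^j / l j)^(1/(p-q))\<close> are chosen so that \<open>h j\<^sup>p l j\<close> (the energy bound) and
  \<open>2^j h j\<^sup>q\<close> (the mass bound) are both equal to the \<open>j\<close>-th term of the sum \<open>T\<close> in question. The
  Sobolev inequality becomes \<open>T \<le> 2 c\<^sup>q T^(q/p)\<close>, and \<open>q/p < 1\<close>.
\<close>

lemma dyadic_sum_bound:
  assumes sob: "sobolev_inequality c" and c: "0 < c" and \<mu>\<Omega>: "\<mu> \<Omega> < \<infinity>"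
    and J: "finite J" and l: "\<And>j. j \<in> J \<Longrightarrow> 0 < l j"
    and prof: "\<And>j. j \<in> J \<Longrightarrow> profile (2 powr real_of_int j) < ennreal (l j)"
  shows "(\<Sum>j\<in>J. (2 powr real_of_int j) powr (p / (p - q)) * l j powr - (q / (p - q)))
    \<le> (2 * c powr q) powr (p / (p - q))"
proof -
  have p: "0 < p" and q: "0 < q" and pq: "0 < p - q" using one_le_q q_less_p by auto
  define P where "P j = 2 powr real_of_int j" for j :: int
  define h where "h j = (P j / l j) powr (1 / (p - q))" for j
  define T where "T = (\<Sum>j\<in>J. P j powr (p / (p - q)) * l j powr - (q / (p - q)))"
  have P: "0 < P j" for j by (simp add: P_def)
  have h: "0 < h j" if "j \<in> J" for j using l[OF that] P[of j] by (simp add: h_def)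
  have energy: "h j powr p * l j = P j powr (p / (p - q)) * l j powr - (q / (p - q))" if "j \<in> J" for j
  proof -
    have lj: "0 < l j" using l that .
    have "h j powr p * l j = P j powr (p / (p - q)) * (l j powr - (p / (p - q)) * l j powr 1)"
      using lj P[of j] by (simp add: h_def powr_powr powr_divide powr_minus_divide)
    also have "l j powr - (p / (p - q)) * l j powr 1 = l j powr - (q / (p - q))"
      unfolding powr_add[symmetric] using pq by (simp add: field_simps)
    finally show ?thesis .
  qed
  have mass: "P j * h j powr q = P j powr (p / (p - q)) * l j powr - (q / (p - q))" if "j \<in> J" for j
  proof -
    have lj: "0 < l j" using l that .
    have "P j * h j powr q = (P j powr 1 * P j powr (q / (p - q))) * l j powr - (q / (p - q))"
      using lj P[of j] by (simp add: h_def powr_powr powr_divide powr_minus_divide)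
    also have "P j powr 1 * P j powr (q / (p - q)) = P j powr (p / (p - q))"
      unfolding powr_add[symmetric] using pq by (simp add: field_simps)
    finally show ?thesis .
  qed
  have T0: "0 \<le> T" unfolding T_def by (intro sum_nonneg) simp

  have "\<exists>G. G \<subseteq> \<Omega> \<and> ennreal (P j) \<le> \<nu> G \<and> variational_capacity \<mu> p G \<Omega> < ennreal (l j)" if "j \<in> J" for j
    using prof[OF that] unfolding capacity_profile_def INF_less_iff P_def by auto
  then obtain G where G: "\<And>j. j \<in> J \<Longrightarrow> G j \<subseteq> \<Omega>" "\<And>j. j \<in> J \<Longrightarrow> ennreal (P j) \<le> \<nu> (G j)"
    "\<And>j. j \<in> J \<Longrightarrow> variational_capacity \<mu> p (G j) \<Omega> < ennreal (l j)"
    by metis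
  obtain u g B where test: "bounded_test_pair u g B"
    and uG: "\<forall>j\<in>J. \<forall>x\<in>G j. h j \<le> u x"
    and gint: "(\<integral>\<^sup>+ x \<in> \<Omega>. enn_powr (g x) p \<partial>M) \<le> ennreal (\<Sum>j\<in>J. h j powr p * l j)"
    using combined_test_function[of J h l G, OF J h l G(3)] by blast
  note cont = bounded_test_pairD(1)[OF test] and zero = bounded_test_pairD(4)[OF test]
    and wug = bounded_test_pairD(5)[OF test]
  have gT: "(\<integral>\<^sup>+ x \<in> \<Omega>. enn_powr (g x) p \<partial>M) \<le> ennreal T"
    using gint energy by (simp add: T_def cong: sum.cong)
  have "(\<lambda>x. ereal (u x)) \<in> newtonian_zero \<mu> p \<Omega>"
    using gT by (intro bounded_in_newtonian_zero[OF test _ \<mu>\<Omega>]) (simp add: le_less_trans)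
  define f where "f x = ennreal (\<bar>u x\<bar> powr q) * indicator \<Omega> x" for x
  have "enn_powr (\<integral>\<^sup>+ x. f x \<partial>N.M) (1 / q) \<le> ennreal c * enn_powr (\<integral>\<^sup>+ x \<in> \<Omega>. enn_powr (g x) p \<partial>M) (1 / p)"
    using sob \<open>(\<lambda>x. ereal (u x)) \<in> newtonian_zero \<mu> p \<Omega>\<close> cont wug
    unfolding sobolev_inequality_def f_def by blast
  also have "\<dots> \<le> ennreal c * enn_powr (ennreal T) (1 / p)"
    using p by (intro mult_left_mono enn_powr_mono gT) auto
  also have "\<dots> = ennreal (c * T powr (1 / p))"
    using T0 c by (simp add: enn_powr_ennreal flip: ennreal_mult)
  finally have sobT: "enn_powr (\<integral>\<^sup>+ x. f x \<partial>N.M) (1 / q) \<le> ennreal (c * T powr (1 / p))" .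
  then obtain F where F: "(\<integral>\<^sup>+ x. f x \<partial>N.M) = ennreal F" "0 \<le> F"
    by (cases "\<integral>\<^sup>+ x. f x \<partial>N.M") (auto simp: top_unique)
  have "F powr (1 / q) \<le> c * T powr (1 / p)" using sobT F c by (simp add: enn_powr_ennreal)
  then have "(F powr (1 / q)) powr q \<le> (c * T powr (1 / p)) powr q"
    using q by (intro powr_mono2) auto
  then have F_le: "F \<le> c powr q * T powr (q / p)"
    using F q c by (simp add: powr_powr powr_mult)

  have "u \<in> borel_measurable borel" by (rule borel_measurable_of_continuous_on_domain[OF cont zero])
  then have f: "f \<in> borel_measurable borel"
    unfolding f_def using open_domain by simp
  have "(\<Sum>j\<in>J. ennreal (2 powr real_of_int j) * ennreal (h j powr q)) \<le> 2 * (\<integral>\<^sup>+ x. f x \<partial>N.M)"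
  proof (rule sum_level_sets_le_nn_integral[OF J N.borel_measurableD[OF f]])
    fix j assume j: "j \<in> J"
    have "{x \<in> space borel. ennreal (h j powr q) \<le> f x} \<in> sets borel" using f by measurable
    then have sets: "{x. ennreal (h j powr q) \<le> f x} \<in> sets N.M"
      using N.sets_borelD by (simp only: space_borel UNIV_I simp_thms)
    have "G j \<subseteq> {x. ennreal (h j powr q) \<le> f x}"
    proof
      fix x assume x: "x \<in> G j"
      have "h j powr q \<le> \<bar>u x\<bar> powr q" using bspec[OF bspec[OF uG j] x] h[OF j] q by (intro powr_mono2) auto
      then show "x \<in> {x. ennreal (h j powr q) \<le> f x}" using G(1)[OF j] x by (auto simp: f_def ennreal_leI)
    qed
    then have "ennreal (P j) \<le> \<nu> {x. ennreal (h j powr q) \<le> f x}"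
      using G(2)[OF j] N.outer_mono order_trans by blast
    then show "ennreal (2 powr real_of_int j) \<le> emeasure N.M {x \<in> space N.M. ennreal (h j powr q) \<le> f x}"
      using sets by (simp add: N.emeasure_eq P_def)
  qed simp
  also have "(\<Sum>j\<in>J. ennreal (2 powr real_of_int j) * ennreal (h j powr q)) = ennreal T"
  proof -
    have "(\<Sum>j\<in>J. ennreal (2 powr real_of_int j) * ennreal (h j powr q)) = (\<Sum>j\<in>J. ennreal (P j * h j powr q))"
      by (simp add: P_def flip: ennreal_mult)
    also have "\<dots> = ennreal (\<Sum>j\<in>J. P j * h j powr q)" using P by (intro sum_ennreal) (simp add: less_imp_le)
    finally show ?thesis using mass by (simp add: T_def cong: sum.cong)
  qed
  finally have "ennreal T \<le> 2 * ennreal F" by (simp add: F)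
  also have "\<dots> = ennreal (2 * F)" using F(2) by (simp add: ennreal_mult)
  finally have "T \<le> 2 * F" using F(2) by simp
  then have T_le: "T \<le> 2 * c powr q * T powr (q / p)" using F_le by simp
  have "T \<le> (2 * c powr q) powr (p / (p - q))"
  proof (cases "T = 0")
    case False
    then have T: "0 < T" using T0 by simp
    have "T powr ((p - q) / p) = T / T powr (q / p)"
      using T p by (simp add: diff_divide_distrib powr_diff)
    also have "\<dots> \<le> 2 * c powr q" using T_le T by (simp add: field_simps)
    finally have "(T powr ((p - q) / p)) powr (p / (p - q)) \<le> (2 * c powr q) powr (p / (p - q))"
      using p pq by (intro powr_mono2) auto
    then show ?thesis using T p pq by (simp add: powr_powr)
  qed simp
  then show ?thesis by (simp add: T_def P_def)
qed

text \<open>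
  On the dyadic interval \<open>I k\<close> the profile is at least its value at the left end, so the integral over
  \<open>I k\<close> is at most a multiple of the term of the dyadic sum for \<open>l k = 2 profile (P k)\<close>. This
  choice of \<open>l k\<close> exceeds the profile because the profile is positive: otherwise \<open>l k\<close> could be
  taken arbitrarily small in the bound for the single term \<open>k\<close>.
\<close>

lemma profile_integral_finite:
  assumes sob: "sobolev_inequality c" and c: "0 < c" and \<mu>\<Omega>: "\<mu> \<Omega> < \<infinity>"
  shows "profile_integral < \<infinity>"
proof -
  have p: "0 < p" and q: "0 < q" and pq: "0 < p - q" using one_le_q q_less_p by auto
  define \<beta> where "\<beta> = q / (p - q)"
  have \<beta>: "0 < \<beta>" and \<alpha>: "p / (p - q) = 1 + \<beta>" and \<beta>': "p / q * \<beta> = 1 + \<beta>"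
    using q pq by (auto simp: \<beta>_def field_simps)
  define P where "P j = 2 powr real_of_int j" for j :: int
  have P: "0 < P j" for j by (simp add: P_def)
  define C where "C = (2 * c powr q) powr (p / (p - q))"
  have C: "0 \<le> C" by (simp add: C_def)
  note dyadic = dyadic_sum_bound[OF sob c \<mu>\<Omega>, unfolded \<alpha> \<beta>_def[symmetric], folded P_def]

  have pos: "0 < profile (P k)" for k
  proof (rule ccontr)
    assume "\<not> 0 < profile (P k)"
    then have z: "profile (P k) = 0" by simp
    define D where "D = (C + 1) / P k powr (1 + \<beta>)"
    have D: "0 < D" using C P[of k] by (simp add: D_def)
    \<comment> \<open>For this \<open>l k\<close> the term would be equal to \<open>C + 1\<close>.\<close>
    have "P k powr (1 + \<beta>) * (D powr - (1 / \<beta>)) powr - \<beta> \<le> C"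
      using dyadic[of "{k}" "\<lambda>_. D powr - (1 / \<beta>)"] D z by (simp add: C_def \<alpha>)
    moreover have "(D powr - (1 / \<beta>)) powr - \<beta> = D" using \<beta> D by (simp add: powr_powr)
    ultimately show False using P[of k] by (simp add: D_def)
  qed

  define I where "I k = {P k..<P (k + 1)}" for k
  define l where "l k = 2 * enn2real (profile (P k))" for k
  have piece: "(\<integral>\<^sup>+ t \<in> I k. integrand t \<partial>lborel) \<le> ennreal (4 powr \<beta>) * ennreal (P k powr (1 + \<beta>) * l k powr - \<beta>)"
    if fin: "profile (P k) < \<infinity>" for k
  proof -
    obtain r where r: "profile (P k) = ennreal r" "0 < r"
      using fin pos[of k] by (cases "profile (P k)") auto
    have P_Suc: "P (k + 1) = 2 * P k" by (simp add: P_def powr_add)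
    have le: "integrand t \<le> ennreal (P (k + 1) powr \<beta> * r powr - \<beta>)" if t: "t \<in> I k" for t
    proof -
      have t0: "0 < t" "P k \<le> t" "t < P (k + 1)" using t P[of k] by (auto simp: I_def)
      have "ennreal r \<le> profile t" using profile_mono[OF t0(2)] r by simp
      then have "ennreal (t powr (p / q)) / profile t \<le> ennreal (t powr (p / q)) / ennreal r"
        by (rule divide_left_mono_ennreal)
      then have "enn_powr (ennreal (t powr (p / q)) / profile t) \<beta> \<le> enn_powr (ennreal (t powr (p / q) / r)) \<beta>"
        using r \<beta> by (intro enn_powr_mono) (simp_all add: divide_ennreal)
      from divide_right_mono_ennreal[OF this, of "ennreal t"]
      have "integrand t \<le> ennreal ((t powr (p / q) / r) powr \<beta> / t)"
        unfolding integrand_def \<beta>_def[symmetric] using t0 r by (simp add: enn_powr_ennreal divide_ennreal)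
      also have "(t powr (p / q) / r) powr \<beta> / t = t powr (p / q * \<beta> - 1) * r powr - \<beta>"
        using t0 r by (simp add: powr_divide powr_powr powr_diff powr_minus_divide)
      also have "p / q * \<beta> - 1 = \<beta>" using \<beta>' by simp
      also have "ennreal (t powr \<beta> * r powr - \<beta>) \<le> ennreal (P (k + 1) powr \<beta> * r powr - \<beta>)"
        using t0 \<beta> by (intro ennreal_leI mult_right_mono powr_mono2) auto
      finally show ?thesis .
    qed
    have "(\<integral>\<^sup>+ t \<in> I k. integrand t \<partial>lborel) \<le> (\<integral>\<^sup>+ t \<in> I k. ennreal (P (k + 1) powr \<beta> * r powr - \<beta>) \<partial>lborel)"
      using le by (intro nn_integral_mono) (auto split: split_indicator)
    also have "\<dots> = ennreal (P (k + 1) powr \<beta> * r powr - \<beta>) * ennreal (P k)"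
      using P[of k] by (simp add: I_def nn_integral_cmult_indicator P_Suc)
    also have "\<dots> = ennreal (4 powr \<beta>) * ennreal (P k powr (1 + \<beta>) * l k powr - \<beta>)"
    proof -
      have "4 powr \<beta> = 2 powr \<beta> * (2 :: real) powr \<beta>" by (simp flip: powr_mult)
      then have "(P (k + 1) powr \<beta> * r powr - \<beta>) * P k = 4 powr \<beta> * (P k powr (1 + \<beta>) * l k powr - \<beta>)"
        using r P[of k] by (simp add: l_def P_Suc powr_mult powr_add powr_minus_divide)
      then show ?thesis using P[of k] by (simp flip: ennreal_mult)
    qed
    finally show ?thesis .
  qed
  have piece0: "(\<integral>\<^sup>+ t \<in> I k. integrand t \<partial>lborel) = 0" if top: "profile (P k) = \<infinity>" for k
  proof -
    have "integrand t * indicator (I k) t = 0" for t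
    proof (cases "t \<in> I k")
      case True
      then have "profile t = top" using profile_mono[of "P k" t] top by (auto simp: I_def top_unique)
      then show ?thesis by (simp add: integrand_def)
    qed simp
    then have "(\<lambda>t. integrand t * indicator (I k) t) = (\<lambda>_. 0)" by (rule ext)
    then show ?thesis by (simp only: nn_integral_0_iff_AE nn_integral_const mult_zero_left)
  qed

  define A where "A n = {t. P (- int n) \<le> t \<and> t < P (int n)}" for n :: nat
  have A_le: "(\<integral>\<^sup>+ t \<in> A n. integrand t \<partial>lborel) \<le> ennreal (4 powr \<beta> * C)" for n
  proof -
    define J where "J = {k \<in> {- int n..<int n}. profile (P k) < \<infinity>}"
    have "finite J" unfolding J_def by (rule finite_subset[of _ "{- int n..<int n}"]) auto
    have "(\<integral>\<^sup>+ t \<in> A n. integrand t \<partial>lborel)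
        \<le> (\<integral>\<^sup>+ t. (\<Sum>k\<in>{- int n..<int n}. integrand t * indicator (I k) t) \<partial>lborel)"
    proof (rule nn_integral_mono)
      fix t
      show "integrand t * indicator (A n) t \<le> (\<Sum>k\<in>{- int n..<int n}. integrand t * indicator (I k) t)"
      proof (cases "t \<in> A n")
        case True
        then have t: "0 < t" "P (- int n) \<le> t" "t < P (int n)" using P[of "- int n"] by (auto simp: A_def)
        define k where "k = \<lfloor>log 2 t\<rfloor>"
        have "P k \<le> t" "t < P (k + 1)"
          using t(1) unfolding k_def P_def
          by (simp_all add: le_log_iff[symmetric] log_less_iff[symmetric])
        then have k: "t \<in> I k" by (simp add: I_def)
        have "P (- int n) < P (k + 1)" "P k < P (int n)"
          using t \<open>P k \<le> t\<close> \<open>t < P (k + 1)\<close> by simp_all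
        then have "k \<in> {- int n..<int n}" unfolding P_def by simp
        then have "integrand t * indicator (I k) t \<le> (\<Sum>k\<in>{- int n..<int n}. integrand t * indicator (I k) t)"
          by (intro member_le_sum) auto
        then show ?thesis using k True by simp
      qed simp
    qed
    also have "\<dots> = (\<Sum>k\<in>{- int n..<int n}. \<integral>\<^sup>+ t \<in> I k. integrand t \<partial>lborel)"
      by (intro nn_integral_sum) (simp add: I_def)
    also have "\<dots> = (\<Sum>k\<in>J. \<integral>\<^sup>+ t \<in> I k. integrand t \<partial>lborel)"
      using piece0 by (intro sum.mono_neutral_right) (auto simp: J_def less_top[symmetric])
    also have "\<dots> \<le> (\<Sum>k\<in>J. ennreal (4 powr \<beta>) * ennreal (P k powr (1 + \<beta>) * l k powr - \<beta>))"
      by (intro sum_mono piece) (simp add: J_def)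
    also have "\<dots> = ennreal (4 powr \<beta>) * ennreal (\<Sum>k\<in>J. P k powr (1 + \<beta>) * l k powr - \<beta>)"
      by (simp add: sum_distrib_left[symmetric] sum_ennreal)
    also have "\<dots> \<le> ennreal (4 powr \<beta>) * ennreal C"
    proof (intro mult_left_mono ennreal_leI)
      have "0 < l k \<and> profile (P k) < ennreal (l k)" if "k \<in> J" for k
      proof -
        have "profile (P k) < \<infinity>" using that by (simp add: J_def)
        then obtain r where "profile (P k) = ennreal r" "0 < r"
          using pos[of k] by (cases "profile (P k)") auto
        then show ?thesis by (simp add: l_def ennreal_lessI)
      qed
      then show "(\<Sum>k\<in>J. P k powr (1 + \<beta>) * l k powr - \<beta>) \<le> C"
        unfolding C_def \<alpha> using \<open>finite J\<close> by (intro dyadic) auto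
    qed simp
    also have "\<dots> = ennreal (4 powr \<beta> * C)" using C by (simp add: ennreal_mult)
    finally show ?thesis .
  qed
  have A_sets: "A n \<in> sets borel" for n
  proof -
    have "A n = {P (- int n)..<P (int n)}" by (auto simp: A_def)
    then show ?thesis by simp
  qed
  have "profile_integral \<le> (\<integral>\<^sup>+ t \<in> (\<Union>n. A n). integrand t \<partial>lborel)"
    unfolding profile_integral_def
  proof (rule nn_integral_mono)
    fix t
    have "t \<in> (\<Union>n. A n)" if t: "0 < t"
    proof -
      obtain n where n: "\<bar>log 2 t\<bar> < real n" using reals_Archimedean2 by blast
      then have "P (- int n) \<le> t" "t < P (int n)"
        using t unfolding P_def by (auto simp: le_log_iff[symmetric] log_less_iff[symmetric])
      then show ?thesis by (auto simp: A_def)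
    qed
    then show "integrand t * indicator {t. 0 < t \<and> ennreal t < \<nu> \<Omega>} t \<le> integrand t * indicator (\<Union>n. A n) t"
      by (auto split: split_indicator)
  qed
  also have "\<dots> = emeasure (density lborel integrand) (\<Union>n. A n)"
    using A_sets by (subst emeasure_density) auto
  also have "\<dots> = (SUP n. emeasure (density lborel integrand) (A n))"
  proof (rule SUP_emeasure_incseq[symmetric])
    have P_mono: "P j \<le> P k" if "j \<le> k" for j k using that by (simp add: P_def)
    show "incseq A"
    proof (rule incseq_SucI, rule subsetI)
      fix n t assume "t \<in> A n"
      then show "t \<in> A (Suc n)"
        using P_mono[of "- int (Suc n)" "- int n"] P_mono[of "int n" "int (Suc n)"] by (auto simp: A_def)
    qed
  qed (use A_sets in auto)
  also have "\<dots> \<le> ennreal (4 powr \<beta> * C)"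
    using A_sets A_le by (intro SUP_least) (simp add: emeasure_density)
  also have "\<dots> < \<infinity>" by simp
  finally show ?thesis .
qed

lemma newtonian_zero_vanishes:
  "(\<lambda>x. ereal (u x)) \<in> newtonian_zero \<mu> p \<Omega> \<Longrightarrow> x \<notin> \<Omega> \<Longrightarrow> u x = 0"
  unfolding newtonian_zero_def by (auto dest: fun_cong[of _ _ x])

end

theorem theorem3p10:
  fixes \<mu> \<nu> :: "'a::metric_space set \<Rightarrow> ennreal"
    and \<Omega> :: "'a set"
    and p q :: real
  assumes "borel_regular_outer_measure \<mu>"
    and "\<And>x r. r > 0 \<Longrightarrow> 0 < \<mu> (ball x r) \<and> \<mu> (ball x r) < \<infinity>"
    and "open \<Omega>" and "bounded \<Omega>" and "\<mu> \<Omega> < \<infinity>"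
    and "borel_regular_outer_measure \<nu>"
    and "1 \<le> q" and "q < p"
  shows
    "(\<integral>\<^sup>+ t \<in> {t. 0 < t \<and> ennreal t < \<nu> \<Omega>}.
         enn_powr (ennreal (t powr (p / q)) / capacity_profile \<mu> \<nu> p \<Omega> t) (q / (p - q)) / ennreal t
       \<partial>lborel) < \<infinity>
     \<longleftrightarrow>
     (\<exists>c\<^sub>S :: real. c\<^sub>S > 0 \<and>
        (\<forall>(u :: 'a \<Rightarrow> real) g.
           (\<lambda>x. ereal (u x)) \<in> newtonian_zero \<mu> p \<Omega> \<longrightarrow> continuous_on \<Omega> u \<longrightarrow>
           weak_upper_gradient \<mu> p (\<lambda>x. ereal (u x)) g \<longrightarrow>
           enn_powr (\<integral>\<^sup>+ x \<in> \<Omega>. ennreal (\<bar>u x\<bar> powr q) \<partial>caratheodory_measure \<nu>) (1 / q)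
             \<le> ennreal c\<^sub>S * enn_powr (\<integral>\<^sup>+ x \<in> \<Omega>. enn_powr (g x) p \<partial>caratheodory_measure \<mu>) (1 / p)))"
proof -
  interpret capacity_setting \<mu> \<nu> \<Omega> p q
    using assms by unfold_locales auto
  have eq: "(\<integral>\<^sup>+ t \<in> {t. 0 < t \<and> ennreal t < \<nu> \<Omega>}.
         enn_powr (ennreal (t powr (p / q)) / capacity_profile \<mu> \<nu> p \<Omega> t) (q / (p - q)) / ennreal t
       \<partial>lborel) = profile_integral"
    by (simp add: profile_integral_def integrand_def)
  have "profile_integral < \<infinity> \<longleftrightarrow> (\<exists>c>0. sobolev_inequality c)"
  proof
    assume "profile_integral < \<infinity>"
    from sobolev_of_profile_integral[OF this]
    show "\<exists>c>0. sobolev_inequality c"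
      unfolding sobolev_inequality_def using newtonian_zero_vanishes by blast
  next
    assume "\<exists>c>0. sobolev_inequality c"
    then show "profile_integral < \<infinity>"
      using profile_integral_finite assms(5) by blast
  qed
  then show ?thesis
    unfolding eq sobolev_inequality_def .
qed

end
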